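(* Let $p\ge 2$, let $h:\mathbb{R}\to[0,\infty)$ be a continuous function which is positive on $\mathbb{R}\setminus\{0\}$, and let $H$ be an arbitrarily chosen locally absolutely continuous primitive of $h$ on $\mathbb{R}$ (so $H'=h$). Let $$\mathcal{R}:=\Big\{ f\in W^{2,1}_{loc}(\mathbb{R}) : \liminf_{r\to+\infty}|f'(r)|^{p-1}|H(f(r))|=\liminf_{r\to-\infty}|f'(r)|^{p-1}|H(f(r))|=0\Big\}.$$ Then for every $f\in\mathcal{R}$, $$\int_{\mathbb{R}}|f'(x)|^p h(f(x))\,dx\le \left(\sqrt{p-1}\right)^p\int_{\mathbb{R}}\left|f''(x)\,\mathcal{T}_h(f(x))\right|^{\frac p2}h(f(x))\,dx .$$
   Context: The transform of $h$ (relative to the chosen primitive $H$) is $\mathcal{T}_h(\lambda):=H(\lambda)/h(\lambda)$ if $h(\lambda)\ne 0$, and $\mathcal{T}_h(\lambda):=0$ if $h(\lambda)=0$. Here $f\in W^{2,1}_{loc}$ is identified with its $C^1$ representative whose derivative $f'$ is locally absolutely continuous; $f''$ is the a.e. defined second derivative. Functions are real valued, and integrals of nonnegative functions are taken in $[0,+\infty]$. *)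

theory Defs
  imports "HOL-Analysis.Analysis"
begin

text \<open>
  Absolute continuity in the usual epsilon-delta sense.  A finite family of non-overlapping
  subintervals of \<open>[a, b]\<close> is given by the finite set \<open>P\<close> of its pairs of endpoints.
\<close>

definition abs_continuous_on_Icc :: "real \<Rightarrow> real \<Rightarrow> (real \<Rightarrow> real) \<Rightarrow> bool" where
  "abs_continuous_on_Icc a b F \<longleftrightarrow>
    (\<forall>\<epsilon>>0. \<exists>\<delta>>0. \<forall>P. finite P \<longrightarrow>
       (\<forall>(u, v)\<in>P. a \<le> u \<and> u \<le> v \<and> v \<le> b) \<longrightarrow>
       disjoint_family_on (\<lambda>(u, v). {u<..<v}) P \<longrightarrow>
       (\<Sum>(u, v)\<in>P. v - u) < \<delta> \<longrightarrow>
       (\<Sum>(u, v)\<in>P. \<bar>F v - F u\<bar>) < \<epsilon>)"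

definition locally_abs_continuous :: "(real \<Rightarrow> real) \<Rightarrow> bool" where
  "locally_abs_continuous F \<longleftrightarrow> (\<forall>a b. a < b \<longrightarrow> abs_continuous_on_Icc a b F)"

text \<open>
  \<open>W\<^sup>2\<^sup>,\<^sup>1\<close> local on the real line, each class being identified with its \<open>C\<^sup>1\<close> representative.
  Continuity of the derivative is part of its local absolute continuity.  The second derivative
  of \<open>f\<close> is \<open>deriv (deriv f)\<close>; on the null set where \<open>deriv f\<close> is not differentiable its value
  is unspecified and does not affect integrals.
\<close>

definition W21_loc :: "(real \<Rightarrow> real) set" where
  "W21_loc = {f. (\<forall>x. f differentiable (at x)) \<and> locally_abs_continuous (deriv f)}"

definition transform :: "(real \<Rightarrow> real) \<Rightarrow> (real \<Rightarrow> real) \<Rightarrow> real \<Rightarrow> real" where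
  "transform H h t = (if h t \<noteq> 0 then H t / h t else 0)"

definition admissible :: "real \<Rightarrow> (real \<Rightarrow> real) \<Rightarrow> (real \<Rightarrow> real) set" where
  "admissible p H = {f \<in> W21_loc.
     Liminf at_top (\<lambda>r. ereal (\<bar>deriv f r\<bar> powr (p - 1) * \<bar>H (f r)\<bar>)) = 0 \<and>
     Liminf at_bot (\<lambda>r. ereal (\<bar>deriv f r\<bar> powr (p - 1) * \<bar>H (f r)\<bar>)) = 0}"

end

theory Submission
  imports Defs
begin

text \<open>
  Write \<open>g = f'\<close> and \<open>\<phi> = |g|\<^sup>p\<^sup>-\<^sup>2 g H(f)\<close>.  This function is locally absolutely continuous, and almost
  everywhere
  \<open>\<phi>' = (p - 1) |g|\<^sup>p\<^sup>-\<^sup>2 g' H(f) + |g|\<^sup>p h(f)\<close>.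
  Where \<open>h(f) \<noteq> 0\<close>, \<open>H(f)\<close> is the transform at \<open>f\<close> times \<open>h(f)\<close>.  Where \<open>h(f) = 0\<close>, one has \<open>f = 0\<close>, and
  almost everywhere on that set \<open>g = 0\<close> and \<open>g' = 0\<close> as well, because zeros with nonzero derivative are
  isolated (lemma \<open>negligible_zeros_with_nonzero_derivative\<close>).  Young's inequality therefore gives,
  almost everywhere,
  \<open>\<phi>' \<ge> (2 / p) (A - C B)\<close>
  where \<open>A\<close> and \<open>B\<close> are the integrands on the left and on the right of the theorem and \<open>C\<close> is its
  constant (lemmas \<open>spow_deriv_Young\<close> and \<open>Young_derivative_bound\<close>).  Integrating over \<open>[a, b]\<close> bounds
  the integral of \<open>A\<close> by \<open>C\<close> times that of \<open>B\<close> plus \<open>(p / 2) (\<phi>(b) - \<phi>(a))\<close>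
  (lemma \<open>nn_integral_le_if_derivative_bound\<close>).  The boundary conditions say that \<open>\<phi>\<close> is arbitrarily
  small at suitable \<open>a\<close> and \<open>b\<close> arbitrarily far out, and the inequality on the line follows by monotone
  convergence.

  What this uses from real analysis is that an absolutely continuous function is differentiable almost
  everywhere and is the integral of its derivative.  The first fact
  (\<open>locally_abs_continuous_differentiable_AE\<close>) is deduced from the Vitali covering theorem directly for
  absolutely continuous functions, without splitting them into monotone ones: two finite coverings of a
  set of oscillating difference quotients, one nested in the other, differ by gaps of small total
  length.  The second fact (\<open>abs_continuous_has_integral\<close>) is a short argument with gauges.
\<close>

section \<open>Finite families of intervals\<close>

text \<open>
  Families of intervals with pairwise disjoint interiors, each interval being given by its pair of
  endpoints, as in the definition of absolute continuity.  Distinct members must have disjoint open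
  intervals; degenerate pairs are harmless.
\<close>

definition nonoverlapping :: "(real \<times> real) set \<Rightarrow> bool" where
  "nonoverlapping P \<longleftrightarrow> disjoint_family_on (\<lambda>(u, v). {u<..<v}) P"

lemma nonoverlapping_mono: "nonoverlapping P \<Longrightarrow> Q \<subseteq> P \<Longrightarrow> nonoverlapping Q"
  unfolding nonoverlapping_def by (rule disjoint_family_on_mono)

lemma nonoverlappingI:
  assumes "\<And>u v u' v' x. (u, v) \<in> P \<Longrightarrow> (u', v') \<in> P \<Longrightarrow> u < x \<Longrightarrow> x < v \<Longrightarrow> u' < x \<Longrightarrow> x < v' \<Longrightarrow>
             u = u' \<and> v = v'"
  shows "nonoverlapping P"
  unfolding nonoverlapping_def disjoint_family_on_def using assms by fastforce

lemma nonoverlappingD: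
  assumes "nonoverlapping P" "(u, v) \<in> P" "(u', v') \<in> P" "u < x" "x < v" "u' < x" "x < v'"
  shows "u = u' \<and> v = v'"
  using assms unfolding nonoverlapping_def disjoint_family_on_def by fastforce

lemma nonoverlapping_ordered:
  assumes "nonoverlapping P" "(u, v) \<in> P" "(u', v') \<in> P" "u < v" "u' < v'" "u \<le> u'"
    "(u, v) \<noteq> (u', v')"
  shows "v \<le> u'"
proof (rule ccontr)
  assume "\<not> v \<le> u'"
  then obtain x where "u' < x" "x < min v v'"
    using dense[of u' "min v v'"] assms(5) by auto
  then show False
    using nonoverlappingD[OF assms(1-3), of x] assms(6,7) by auto
qed

lemma measure_nonoverlapping_Union:
  assumes "finite P" "nonoverlapping P" "\<And>u v. (u, v) \<in> P \<Longrightarrow> u \<le> v"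
  shows "measure lebesgue (\<Union>(u, v)\<in>P. {u<..<v}) = (\<Sum>(u, v)\<in>P. v - u)"
proof -
  have "measure lebesgue (\<Union>z\<in>P. case z of (u, v) \<Rightarrow> {u<..<v}) =
      (\<Sum>z\<in>P. measure lebesgue (case z of (u, v) \<Rightarrow> {u<..<v}))"
    by (rule measure_finite_Union)
      (use assms in \<open>auto simp: nonoverlapping_def split: prod.splits\<close>)
  also have "\<dots> = (\<Sum>(u, v)\<in>P. v - u)"
    using assms(3) by (intro sum.cong) (auto split: prod.splits)
  finally show ?thesis by (simp add: case_prod_beta)
qed

text \<open>
  The gaps left in \<open>[c, d]\<close> by a finite nonoverlapping family.  The family of gaps is chosen before
  the function \<open>G\<close>, so that the identity gives the total length of the gaps and another choice of
  \<open>G\<close> gives the sum of its increments over the very same gaps.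
\<close>

lemma complementary_intervals:
  assumes "finite P" "nonoverlapping P" "c \<le> d" "\<And>u v. (u, v) \<in> P \<Longrightarrow> c \<le> u \<and> u < v \<and> v \<le> d"
  obtains Q where "finite Q" "nonoverlapping Q" "\<And>u v. (u, v) \<in> Q \<Longrightarrow> c \<le> u \<and> u < v \<and> v \<le> d"
    "\<And>G :: real \<Rightarrow> real. (\<Sum>(u, v)\<in>P. G v - G u) + (\<Sum>(u, v)\<in>Q. G v - G u) = G d - G c"
proof -
  have "\<exists>Q. finite Q \<and> nonoverlapping Q \<and> (\<forall>(u, v)\<in>Q. c \<le> u \<and> u < v \<and> v \<le> d) \<and>
      (\<forall>G :: real \<Rightarrow> real. (\<Sum>(u, v)\<in>P. G v - G u) + (\<Sum>(u, v)\<in>Q. G v - G u) = G d - G c)"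
    using assms
  proof (induction "card P" arbitrary: P d)
    case 0
    then have "P = {}" by simp
    then show ?case
      by (intro exI[of _ "if c < d then {(c, d)} else {}"])
        (use 0 in \<open>auto simp: nonoverlapping_def disjoint_family_on_def\<close>)
  next
    case (Suc n)
    \<comment> \<open>Split off the rightmost interval \<open>(u, v)\<close> of the family.\<close>
    have "Max (fst ` P) \<in> fst ` P"
      using Suc.hyps(2) Suc.prems(1) by (intro Max_in) (auto simp: card_eq_0_iff)
    then obtain u v where uv: "(u, v) \<in> P" "u = Max (fst ` P)" by auto
    have umax: "u' \<le> u" if "(u', v') \<in> P" for u' v'
      using that Suc.prems(1) unfolding uv(2) by (intro Max_ge) force+
    let ?P = "P - {(u, v)}"
    have sub: "c \<le> u' \<and> u' < v' \<and> v' \<le> u" if "(u', v') \<in> ?P" for u' v'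
      using that Suc.prems(4) nonoverlapping_ordered[OF Suc.prems(2), of u' v' u v] umax uv(1) by blast
    have card: "n = card ?P" using Suc.hyps(2) uv Suc.prems(1) by simp
    have "finite ?P" "nonoverlapping ?P" "c \<le> u"
      using Suc.prems uv nonoverlapping_mono[of P ?P] by auto
    from Suc.hyps(1)[OF card this]
    have "\<exists>Q. finite Q \<and> nonoverlapping Q \<and> (\<forall>(u', v')\<in>Q. c \<le> u' \<and> u' < v' \<and> v' \<le> u) \<and>
      (\<forall>G :: real \<Rightarrow> real. (\<Sum>(u, v)\<in>?P. G v - G u) + (\<Sum>(u, v)\<in>Q. G v - G u) = G u - G c)"
      using sub by blast
    then obtain Q where Q0: "finite Q" "nonoverlapping Q"
      "\<forall>(u', v')\<in>Q. c \<le> u' \<and> u' < v' \<and> v' \<le> u"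
      "\<forall>G :: real \<Rightarrow> real. (\<Sum>(u, v)\<in>?P. G v - G u) + (\<Sum>(u, v)\<in>Q. G v - G u) = G u - G c"
      by (elim exE conjE)
    have Q3: "c \<le> u' \<and> u' < v' \<and> v' \<le> u" if "(u', v') \<in> Q" for u' v'
      using Q0(3) that by blast
    note Q = Q0(1,2) Q3 Q0(4)[rule_format]
    have uvd: "c \<le> u" "u < v" "v \<le> d" using Suc.prems(4) uv by auto
    have *: "(\<Sum>(u, v)\<in>P. G v - G u) = G v - G u + (\<Sum>(u, v)\<in>?P. G v - G u)" for G :: "real \<Rightarrow> real"
      using Suc.prems(1) uv(1) by (subst sum.remove[of P "(u, v)"]) auto
    show ?case
    proof (cases "v = d")
      case True
      show ?thesis
      proof (intro exI conjI allI)
        show "\<forall>(u, v)\<in>Q. c \<le> u \<and> u < v \<and> v \<le> d" using Q(3) uvd by force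
        show "(\<Sum>(u, v)\<in>P. G v - G u) + (\<Sum>(u, v)\<in>Q. G v - G u) = G d - G c" for G :: "real \<Rightarrow> real"
          using Q(4)[of G] *[of G] True by simp
      qed (use Q in auto)
    next
      case False
      have new: "(v, d) \<notin> Q" using Q(3) uvd by fastforce
      show ?thesis
      proof (intro exI[of _ "insert (v, d) Q"] conjI allI)
        show "\<forall>(u, v)\<in>insert (v, d) Q. c \<le> u \<and> u < v \<and> v \<le> d" using Q(3) uvd False by force
        show "(\<Sum>(u, v)\<in>P. G v - G u) + (\<Sum>(u, v)\<in>insert (v, d) Q. G v - G u) = G d - G c"
          for G :: "real \<Rightarrow> real"
          using Q(4)[of G] *[of G] Q(1) new by simp
        show "nonoverlapping (insert (v, d) Q)"
          by (rule nonoverlappingI) (use Q(3) nonoverlappingD[OF Q(2)] uvd in \<open>fastforce\<close>)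
      qed (use Q in auto)
    qed
  qed
  then obtain Q where Q: "finite Q" "nonoverlapping Q" "\<forall>(u, v)\<in>Q. c \<le> u \<and> u < v \<and> v \<le> d"
    "\<forall>G :: real \<Rightarrow> real. (\<Sum>(u, v)\<in>P. G v - G u) + (\<Sum>(u, v)\<in>Q. G v - G u) = G d - G c"
    by blast
  have Q3: "c \<le> u \<and> u < v \<and> v \<le> d" if "(u, v) \<in> Q" for u v
    using Q(3) that by blast
  show thesis
    by (rule that[OF Q(1,2) Q3 Q(4)[rule_format]])
qed

section \<open>A finite Vitali covering on the line\<close>

text \<open>
  If arbitrarily short intervals with the property \<open>Q\<close> surround every point of \<open>S\<close>, then finitely
  many disjoint ones cover \<open>S\<close> up to measure \<open>\<epsilon>\<close>.
\<close>

lemma Vitali_finite_intervals: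
  fixes S :: "real set"
  assumes S: "S \<in> lmeasurable" and U: "open U" "S \<subseteq> U"
    and fine: "\<And>x e. x \<in> S \<Longrightarrow> 0 < e \<Longrightarrow> \<exists>u v. u < x \<and> x < v \<and> v - u < e \<and> Q u v"
    and \<epsilon>: "0 < \<epsilon>"
  obtains P where "finite P" "nonoverlapping P"
    "\<And>u v. (u, v) \<in> P \<Longrightarrow> u < v \<and> {u..v} \<subseteq> U \<and> Q u v"
    "measure lebesgue (S - (\<Union>(u, v)\<in>P. {u<..<v})) < \<epsilon>"
proof -
  define K where "K = {(c, r). 0 < r \<and> {c - r..c + r} \<subseteq> U \<and> Q (c - r) (c + r)}"
  have "\<exists>i. i \<in> K \<and> x \<in> ball (fst i) (snd i) \<and> snd i < e" if x: "x \<in> S" "0 < e" for x e :: real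
  proof -
    obtain d where d: "0 < d" "ball x d \<subseteq> U" using U x by (meson openE subsetD)
    obtain u v where uv: "u < x" "x < v" "v - u < min d e" "Q u v"
      using fine[OF x(1), of "min d e"] d x by auto
    have "{u..v} \<subseteq> ball x d" using uv by (auto simp: dist_real_def)
    then have "{u..v} \<subseteq> U" using d by blast
    moreover have "(u + v) / 2 - (v - u) / 2 = u" "(u + v) / 2 + (v - u) / 2 = v"
      by (simp_all add: field_simps)
    ultimately show ?thesis
      using uv by (intro exI[of _ "((u + v) / 2, (v - u) / 2)"])
        (auto simp: K_def dist_real_def abs_if field_simps)
  qed
  then obtain C where C: "countable C" "C \<subseteq> K"
    "pairwise (\<lambda>i j. disjnt (ball (fst i) (snd i)) (ball (fst j) (snd j))) C"
    "negligible (S - (\<Union>i\<in>C. ball (fst i) (snd i)))"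
    by (rule Vitali_covering_theorem_balls[of S K fst snd]) blast+
  \<comment> \<open>By continuity of the measure from above, finitely many of these balls suffice.\<close>
  have "\<exists>F. finite F \<and> F \<subseteq> C \<and> measure lebesgue (S - (\<Union>i\<in>F. ball (fst i) (snd i))) < \<epsilon>"
  proof (cases "C = {}")
    case True
    then show ?thesis using C(4) \<epsilon> by (intro exI[of _ "{}"]) (auto simp: negligible_imp_measure0)
  next
    case False
    define A where "A n = S - (\<Union>k<n. ball (fst (from_nat_into C k)) (snd (from_nat_into C k)))" for n
    have "(\<lambda>n. measure lebesgue (A n)) \<longlonglongrightarrow> measure lebesgue (\<Inter>n. A n)"
    proof (rule Lim_measure_decseq)
      have Al: "A n \<in> lmeasurable" for n unfolding A_def
        by (intro fmeasurable_Diff S sets.finite_UN) auto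
      then show "range A \<subseteq> sets lebesgue" by (auto simp: fmeasurable_def)
      show "emeasure lebesgue (A n) \<noteq> \<infinity>" for n using Al[of n] by (auto simp: fmeasurable_def)
      show "decseq A" unfolding decseq_def A_def by fastforce
    qed
    moreover have "(\<Inter>n. A n) = S - (\<Union>i\<in>C. ball (fst i) (snd i))"
    proof -
      have "(\<Inter>n. A n) = S - (\<Union>k. ball (fst (from_nat_into C k)) (snd (from_nat_into C k)))"
        unfolding A_def by blast
      also have "(\<Union>k. ball (fst (from_nat_into C k)) (snd (from_nat_into C k))) =
          (\<Union>i\<in>range (from_nat_into C). ball (fst i) (snd i))" by blast
      finally show ?thesis using False C(1) by (simp add: range_from_nat_into)
    qed
    ultimately have "(\<lambda>n. measure lebesgue (A n)) \<longlonglongrightarrow> 0"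
      using C(4) by (simp add: negligible_imp_measure0)
    then obtain n where "measure lebesgue (A n) < \<epsilon>"
      using order_tendstoD(2)[of _ 0 sequentially \<epsilon>] \<epsilon> by (metis eventually_happens sequentially_bot)
    then show ?thesis
      by (intro exI[of _ "from_nat_into C ` {..<n}"]) (use from_nat_into[OF False] in \<open>auto simp: A_def simp del: surjective_pairing[symmetric]\<close>)
  qed
  then obtain F where F: "finite F" "F \<subseteq> C"
    "measure lebesgue (S - (\<Union>i\<in>F. ball (fst i) (snd i))) < \<epsilon>" by blast
  define P where "P = (\<lambda>(c, r). (c - r, c + r)) ` F"
  have ball: "ball c r = {c - r<..<c + r}" for c r :: real
    by (auto simp: dist_real_def)
  show thesis
  proof
    show "finite P" using F by (simp add: P_def)
    show "u < v \<and> {u..v} \<subseteq> U \<and> Q u v" if "(u, v) \<in> P" for u v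
      using that F(2) C(2) by (auto simp: P_def K_def)
    have "(\<Union>(u, v)\<in>P. {u<..<v}) = (\<Union>i\<in>F. ball (fst i) (snd i))"
      by (auto simp: P_def ball)
    then show "measure lebesgue (S - (\<Union>(u, v)\<in>P. {u<..<v})) < \<epsilon>" using F(3) by simp
    show "nonoverlapping P"
    proof (rule nonoverlappingI)
      fix u v u' v' x
      assume *: "(u, v) \<in> P" "(u', v') \<in> P" "u < x" "x < v" "u' < x" "x < v'"
      then obtain i j where ij: "i \<in> F" "j \<in> F" "u = fst i - snd i" "v = fst i + snd i"
        "u' = fst j - snd j" "v' = fst j + snd j" by (auto simp: P_def)
      then have "x \<in> ball (fst i) (snd i)" "x \<in> ball (fst j) (snd j)" using * by (auto simp: ball)
      then have "i = j" using C(3) F(2) ij(1,2) unfolding pairwise_def disjnt_def by blast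
      then show "u = u' \<and> v = v'" using ij by simp
    qed
  qed
qed

section \<open>Absolutely continuous functions are differentiable almost everywhere\<close>

lemma abs_continuous_on_IccE:
  assumes "abs_continuous_on_Icc a b G" "0 < \<epsilon>"
  obtains \<delta> where "0 < \<delta>" "\<And>P. finite P \<Longrightarrow> nonoverlapping P \<Longrightarrow>
      (\<And>u v. (u, v) \<in> P \<Longrightarrow> a \<le> u \<and> u \<le> v \<and> v \<le> b) \<Longrightarrow>
      (\<Sum>(u, v)\<in>P. v - u) < \<delta> \<Longrightarrow> (\<Sum>(u, v)\<in>P. \<bar>G v - G u\<bar>) < \<epsilon>"
proof -
  obtain \<delta> where \<delta>: "0 < \<delta>" "\<forall>P. finite P \<longrightarrow> (\<forall>(u, v)\<in>P. a \<le> u \<and> u \<le> v \<and> v \<le> b) \<longrightarrow>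
       disjoint_family_on (\<lambda>(u, v). {u<..<v}) P \<longrightarrow>
       (\<Sum>(u, v)\<in>P. v - u) < \<delta> \<longrightarrow> (\<Sum>(u, v)\<in>P. \<bar>G v - G u\<bar>) < \<epsilon>"
    using assms unfolding abs_continuous_on_Icc_def by blast
  show thesis
  proof (rule that[OF \<delta>(1)])
    fix P assume "finite P" "nonoverlapping P" "\<And>u v. (u, v) \<in> P \<Longrightarrow> a \<le> u \<and> u \<le> v \<and> v \<le> b"
      "(\<Sum>(u, v)\<in>P. v - u) < \<delta>"
    then show "(\<Sum>(u, v)\<in>P. \<bar>G v - G u\<bar>) < \<epsilon>"
      using \<delta>(2)[rule_format, of P] unfolding nonoverlapping_def by blast
  qed
qed

text \<open>
  Where difference quotients \<open>\<le> 0\<close> and difference quotients \<open>\<ge> \<beta> > 0\<close> both occur at arbitrarily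
  small scale, there is no mass.  Cover \<open>E\<close> by finitely many intervals \<open>P\<close> on which \<open>G\<close> does not
  increase, inside an open set hardly larger than \<open>E\<close>; then cover \<open>E\<close> again, inside \<open>P\<close>, by intervals
  \<open>P'\<close> on which \<open>G\<close> grows at rate \<open>\<beta>\<close>.  The gaps \<open>P - P'\<close> have small total length, so that by absolute
  continuity \<open>G\<close> varies little over them, and the total increments over \<open>P\<close> (at most \<open>0\<close>)
  and over \<open>P'\<close> (at least about \<open>\<beta>\<close> times the measure of \<open>E\<close>) nearly agree.
\<close>

lemma null_if_oscillating_quotients:
  assumes AC: "abs_continuous_on_Icc a b G" and E: "E \<in> lmeasurable" "E \<subseteq> {a<..<b}" and \<beta>: "0 < \<beta>"
    and low: "\<And>x e. x \<in> E \<Longrightarrow> 0 < e \<Longrightarrow> \<exists>u v. u < x \<and> x < v \<and> v - u < e \<and> G v - G u \<le> 0"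
    and high: "\<And>x e. x \<in> E \<Longrightarrow> 0 < e \<Longrightarrow>
      \<exists>u v. u < x \<and> x < v \<and> v - u < e \<and> \<beta> * (v - u) \<le> G v - G u"
  shows "measure lebesgue E = 0"
proof -
  let ?m = "measure lebesgue E"
  have small: "\<beta> * ?m < 2 * \<epsilon>" if \<epsilon>: "0 < \<epsilon>" for \<epsilon>
  proof -
    obtain \<delta> where \<delta>: "0 < \<delta>" "\<And>P. finite P \<Longrightarrow> nonoverlapping P \<Longrightarrow>
      (\<And>u v. (u, v) \<in> P \<Longrightarrow> a \<le> u \<and> u \<le> v \<and> v \<le> b) \<Longrightarrow>
      (\<Sum>(u, v)\<in>P. v - u) < \<delta> \<Longrightarrow> (\<Sum>(u, v)\<in>P. \<bar>G v - G u\<bar>) < \<epsilon>"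
      using abs_continuous_on_IccE[OF AC \<epsilon>] by metis
    define \<eta> where "\<eta> = min (\<delta> / 3) (\<epsilon> / (2 * \<beta>))"
    have \<eta>: "0 < \<eta>" "3 * \<eta> \<le> \<delta>" "2 * \<beta> * \<eta> \<le> \<epsilon>"
      using \<delta> \<epsilon> \<beta> by (auto simp: \<eta>_def min_def field_simps)
    obtain T where T: "open T" "E \<subseteq> T" "T - E \<in> lmeasurable" "emeasure lebesgue (T - E) < ennreal \<eta>"
      using sets_lebesgue_outer_open[OF _ \<eta>(1)] E(1) by (metis fmeasurableD)
    define U where "U = T \<inter> {a<..<b}"
    have U: "open U" "E \<subseteq> U" "U \<subseteq> {a<..<b}" using T E by (auto simp: U_def)
    have Ul: "U \<in> lmeasurable" using U bounded_subset[OF bounded_box[of a b]] by (auto intro: lmeasurable_open)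
    have mU: "measure lebesgue U < ?m + \<eta>"
    proof -
      have "measure lebesgue (U - E) \<le> measure lebesgue (T - E)"
        using T E Ul by (intro measure_mono_fmeasurable) (auto simp: U_def)
      also have "\<dots> < \<eta>"
        using T(3,4) \<eta> by (simp add: emeasure_eq_measure2 ennreal_less_iff)
      finally show ?thesis
        using measurable_measure_Diff[OF Ul fmeasurableD[OF E(1)] U(2)] by simp
    qed
    obtain P where P: "finite P" "nonoverlapping P"
      "\<And>u v. (u, v) \<in> P \<Longrightarrow> u < v \<and> {u..v} \<subseteq> U \<and> G v - G u \<le> 0"
      "measure lebesgue (E - (\<Union>(u, v)\<in>P. {u<..<v})) < \<eta>"
      using low by (rule Vitali_finite_intervals[OF E(1) U(1,2) _ \<eta>(1), of "\<lambda>u v. G v - G u \<le> 0"])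
        (assumption+, rule that)
    let ?V = "\<Union>(u, v)\<in>P. {u<..<v}"
    have V: "open ?V" by auto
    have Vl: "?V \<in> lmeasurable" using P(1) by (intro fmeasurable.finite_UN) auto
    have "?V \<subseteq> U" using P(3) by fastforce
    then have sumP: "(\<Sum>(u, v)\<in>P. v - u) < ?m + \<eta>"
      using mU measure_mono_fmeasurable[OF \<open>?V \<subseteq> U\<close> _ Ul] Vl P(3)
        measure_nonoverlapping_Union[OF P(1,2)] by (fastforce simp: less_imp_le)
    define S where "S = E \<inter> ?V"
    have S: "S \<in> lmeasurable" "S \<subseteq> ?V" using E Vl by (auto simp: S_def)
    have mS: "?m < measure lebesgue S + \<eta>"
    proof -
      have "?m = measure lebesgue ((E - ?V) \<union> S)"
        unfolding S_def by (rule arg_cong[where f = "measure lebesgue"]) blast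
      also have "\<dots> \<le> measure lebesgue (E - ?V) + measure lebesgue S"
        using E S Vl by (intro measure_Un_le) (auto simp: fmeasurableD)
      finally show ?thesis using P(4) by simp
    qed
    define R where "R u v \<longleftrightarrow> \<beta> * (v - u) \<le> G v - G u \<and> (\<exists>(c, d)\<in>P. c \<le> u \<and> v \<le> d)" for u v
    have "\<exists>u v. u < x \<and> x < v \<and> v - u < e \<and> R u v" if x: "x \<in> S" "0 < e" for x e
    proof -
      obtain c d where cd: "(c, d) \<in> P" "c < x" "x < d" using x by (auto simp: S_def)
      obtain u v where "u < x \<and> x < v \<and> v - u < min e (min (x - c) (d - x)) \<and> \<beta> * (v - u) \<le> G v - G u"
        using high[of x "min e (min (x - c) (d - x))"] x cd by (auto simp: S_def)
      then show ?thesis using cd unfolding R_def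
        by (intro exI[of _ u] exI[of _ v] conjI bexI[of _ "(c, d)"]) auto
    qed
    from this obtain P' where P': "finite P'" "nonoverlapping P'"
      "\<And>u v. (u, v) \<in> P' \<Longrightarrow> u < v \<and> {u..v} \<subseteq> ?V \<and> R u v"
      "measure lebesgue (S - (\<Union>(u, v)\<in>P'. {u<..<v})) < \<eta>"
      by (rule Vitali_finite_intervals[OF S(1) V S(2) _ \<eta>(1), of R])
        (assumption+, rule that)
    let ?V' = "\<Union>(u, v)\<in>P'. {u<..<v}"
    have sumP': "?m - 2 * \<eta> < (\<Sum>(u, v)\<in>P'. v - u)"
    proof -
      have V'l: "?V' \<in> lmeasurable" using P'(1) by (intro fmeasurable.finite_UN) auto
      have "measure lebesgue S \<le> measure lebesgue ((S - ?V') \<union> ?V')"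
        using S V'l by (intro measure_mono_fmeasurable) auto
      also have "\<dots> \<le> measure lebesgue (S - ?V') + measure lebesgue ?V'"
        using S V'l by (intro measure_Un_le) auto
      also have "measure lebesgue ?V' = (\<Sum>(u, v)\<in>P'. v - u)"
        using P' by (intro measure_nonoverlapping_Union) (auto simp: less_imp_le)
      finally show ?thesis using mS P'(4) by simp
    qed
    \<comment> \<open>The intervals of \<open>P'\<close> lying in a given interval \<open>i\<close> of \<open>P\<close>, and the rest \<open>C i\<close> of \<open>i\<close>.\<close>
    define J where "J i = {(u, v) \<in> P'. fst i \<le> u \<and> v \<le> snd i}" for i :: "real \<times> real"
    have Jsub: "J i \<subseteq> P'" for i by (auto simp: J_def)
    have J: "finite (J i)" "nonoverlapping (J i)" for i
      using finite_subset[OF Jsub P'(1)] nonoverlapping_mono[OF P'(2) Jsub] by auto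
    have "\<exists>Q. finite Q \<and> nonoverlapping Q \<and> (\<forall>u v. (u, v) \<in> Q \<longrightarrow> fst i \<le> u \<and> u < v \<and> v \<le> snd i) \<and>
        (\<forall>G :: real \<Rightarrow> real. (\<Sum>(u, v)\<in>J i. G v - G u) + (\<Sum>(u, v)\<in>Q. G v - G u) = G (snd i) - G (fst i))"
      if i: "i \<in> P" for i
    proof -
      have "fst i \<le> snd i" using P(3)[of "fst i" "snd i"] i by simp
      moreover have "fst i \<le> u \<and> u < v \<and> v \<le> snd i" if "(u, v) \<in> J i" for u v
        using that P'(3) by (auto simp: J_def)
      ultimately obtain Q where "finite Q" "nonoverlapping Q"
        "\<And>u v. (u, v) \<in> Q \<Longrightarrow> fst i \<le> u \<and> u < v \<and> v \<le> snd i"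
        "\<And>G :: real \<Rightarrow> real. (\<Sum>(u, v)\<in>J i. G v - G u) + (\<Sum>(u, v)\<in>Q. G v - G u) = G (snd i) - G (fst i)"
        by (rule complementary_intervals[OF J[of i]]) (assumption, rule that)
      note Q = this
      show ?thesis using Q(3) by (intro exI[of _ Q] conjI allI Q(1,2,4)) blast
    qed
    then obtain C where C: "\<And>i. i \<in> P \<Longrightarrow> finite (C i)" "\<And>i. i \<in> P \<Longrightarrow> nonoverlapping (C i)"
      "\<And>i u v. i \<in> P \<Longrightarrow> (u, v) \<in> C i \<Longrightarrow> fst i \<le> u \<and> u < v \<and> v \<le> snd i"
      "\<And>i G :: real \<Rightarrow> real. i \<in> P \<Longrightarrow>
        (\<Sum>(u, v)\<in>J i. G v - G u) + (\<Sum>(u, v)\<in>C i. G v - G u) = G (snd i) - G (fst i)"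
      by metis
    have inside: "i = j" if i: "i \<in> P" "j \<in> P" and "fst i \<le> u" "fst j \<le> u" "u < v" "v \<le> snd i" "v \<le> snd j"
      for i j u v
      using nonoverlappingD[OF P(2), of "fst i" "snd i" "fst j" "snd j" "(u + v) / 2"] that
      by (auto simp: prod_eq_iff)
    let ?Q = "\<Union>i\<in>P. C i"
    have decomp: "(\<Sum>(u, v)\<in>P'. g v - g u) + (\<Sum>(u, v)\<in>?Q. g v - g u) = (\<Sum>(u, v)\<in>P. g v - g u)"
      for g :: "real \<Rightarrow> real"
    proof -
      have "P' = (\<Union>i\<in>P. J i)"
      proof (intro equalityI subsetI)
        fix z assume z: "z \<in> P'"
        obtain u v where [simp]: "z = (u, v)" by fastforce
        have "R u v" using P'(3)[of u v] z by simp
        then obtain i where "i \<in> P" "fst i \<le> u" "v \<le> snd i" unfolding R_def by auto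
        then show "z \<in> (\<Union>i\<in>P. J i)" using z by (auto simp: J_def)
      qed (use Jsub in blast)
      then have "(\<Sum>(u, v)\<in>P'. g v - g u) = (\<Sum>z\<in>(\<Union>i\<in>P. J i). case z of (u, v) \<Rightarrow> g v - g u)" by simp
      also have "\<dots> = (\<Sum>i\<in>P. \<Sum>(u, v)\<in>J i. g v - g u)"
      proof (intro sum.UNION_disjoint ballI impI P(1) J(1))
        fix i j assume ij: "i \<in> P" "j \<in> P" "i \<noteq> j"
        have "(u, v) \<notin> J i \<or> (u, v) \<notin> J j" for u v
          using inside[OF ij(1,2), of u v] P'(3)[of u v] ij(3) unfolding J_def by auto
        then show "J i \<inter> J j = {}" by auto
      qed
      finally have 1: "(\<Sum>(u, v)\<in>P'. g v - g u) = (\<Sum>i\<in>P. \<Sum>(u, v)\<in>J i. g v - g u)" .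
      have 2: "(\<Sum>(u, v)\<in>?Q. g v - g u) = (\<Sum>i\<in>P. \<Sum>(u, v)\<in>C i. g v - g u)"
      proof (intro sum.UNION_disjoint ballI impI P(1) C(1))
        fix i j assume ij: "i \<in> P" "j \<in> P" "i \<noteq> j"
        have "(u, v) \<notin> C i \<or> (u, v) \<notin> C j" for u v
          using inside[OF ij(1,2), of u v] C(3)[of i u v] C(3)[of j u v] ij by auto
        then show "C i \<inter> C j = {}" by auto
      qed
      show ?thesis unfolding 1 2 sum.distrib[symmetric]
        by (intro sum.cong refl) (use C(4)[of _ g] in \<open>simp add: case_prod_beta\<close>)
    qed
    have "(\<Sum>(u, v)\<in>?Q. v - u) < \<delta>"
      using decomp[of "\<lambda>x. x"] sumP sumP' \<eta> by simp
    moreover have "nonoverlapping ?Q"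
    proof (rule nonoverlappingI)
      fix u v u' v' x
      assume *: "(u, v) \<in> ?Q" "(u', v') \<in> ?Q" "u < x" "x < v" "u' < x" "x < v'"
      then obtain i j where ij: "i \<in> P" "j \<in> P" "(u, v) \<in> C i" "(u', v') \<in> C j" by auto
      then have "i = j"
        using inside[of i j "max u u'" "min v v'"] C(3)[OF ij(1,3)] C(3)[OF ij(2,4)] *(3-6) by auto
      then show "u = u' \<and> v = v'" using nonoverlappingD[OF C(2)] ij * by metis
    qed
    moreover have "a \<le> u \<and> u \<le> v \<and> v \<le> b" if uv: "(u, v) \<in> ?Q" for u v
    proof -
      obtain i where i: "i \<in> P" "(u, v) \<in> C i" using uv by blast
      have "fst i \<in> U" "snd i \<in> U" using P(3)[of "fst i" "snd i"] i by auto
      then have "a < fst i" "snd i < b" using U(3) by auto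
      then show ?thesis using C(3)[OF i] by auto
    qed
    ultimately have "(\<Sum>(u, v)\<in>?Q. \<bar>G v - G u\<bar>) < \<epsilon>"
      using P(1) C(1) by (intro \<delta>(2)) auto
    moreover have "(\<Sum>(u, v)\<in>?Q. -(G v - G u)) \<le> (\<Sum>(u, v)\<in>?Q. \<bar>G v - G u\<bar>)"
      by (intro sum_mono) auto
    moreover have "(\<Sum>(u, v)\<in>P. G v - G u) \<le> 0"
      using P(3) by (intro sum_nonpos) auto
    moreover have "\<beta> * (\<Sum>(u, v)\<in>P'. v - u) \<le> (\<Sum>(u, v)\<in>P'. G v - G u)"
      using P'(3) unfolding sum_distrib_left by (intro sum_mono) (auto simp: R_def)
    moreover have "(\<Sum>(u, v)\<in>?Q. -(G v - G u)) = -(\<Sum>(u, v)\<in>?Q. G v - G u)"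
      by (simp add: sum_negf[symmetric] case_prod_beta)
    ultimately have "\<beta> * (\<Sum>(u, v)\<in>P'. v - u) < \<epsilon>"
      using decomp[of G] by linarith
    moreover have "\<beta> * (?m - 2 * \<eta>) \<le> \<beta> * (\<Sum>(u, v)\<in>P'. v - u)"
      using \<beta> sumP' by simp
    ultimately show ?thesis using \<eta>(3) by (simp add: algebra_simps)
  qed
  have "\<beta> * ?m \<le> 0"
    using small[of "\<beta> * ?m / 2"] by (cases "0 < \<beta> * ?m") auto
  then show ?thesis using \<beta> by (metis measure_nonneg mult_le_0_iff not_less antisym)
qed

text \<open>
  The set of points surrounded by arbitrarily short open intervals whose endpoints satisfy \<open>T\<close>.  Using
  open intervals around the point, instead of difference quotients at the point, makes the set a
  countable intersection of open sets, whatever \<open>T\<close> is.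
\<close>

definition finely_covered :: "(real \<Rightarrow> real \<Rightarrow> bool) \<Rightarrow> real set" where
  "finely_covered T = {x. \<forall>e>0. \<exists>u v. u < x \<and> x < v \<and> v - u < e \<and> T u v}"

lemma finely_covered_sets: "finely_covered T \<in> sets lebesgue"
proof -
  have "finely_covered T = (\<Inter>n. \<Union>(u, v)\<in>{(u, v). v - u < inverse (real (Suc n)) \<and> T u v}. {u<..<v})"
    (is "_ = (\<Inter>n. ?O n)")
  proof (intro equalityI subsetI)
    fix x assume x: "x \<in> (\<Inter>n. ?O n)"
    show "x \<in> finely_covered T" unfolding finely_covered_def
    proof (intro CollectI allI impI)
      fix e :: real assume "0 < e"
      then obtain n where "inverse (real (Suc n)) < e" using reals_Archimedean by blast
      moreover have "x \<in> ?O n" using x by blast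
      ultimately show "\<exists>u v. u < x \<and> x < v \<and> v - u < e \<and> T u v" by fastforce
    qed
  next
    fix x assume x: "x \<in> finely_covered T"
    have "x \<in> ?O n" for n
    proof -
      have "0 < inverse (real (Suc n))" by simp
      then obtain u v where "u < x" "x < v" "v - u < inverse (real (Suc n))" "T u v"
        using x unfolding finely_covered_def by blast
      then show ?thesis by force
    qed
    then show "x \<in> (\<Inter>n. ?O n)" by blast
  qed
  also have "\<dots> \<in> sets borel"
  proof -
    have "open (?O n)" for n by (intro open_UN ballI) auto
    then show ?thesis by (intro sets.countable_INT') auto
  qed
  finally show ?thesis by simp
qed

lemma finely_coveredD:
  "x \<in> finely_covered T \<Longrightarrow> 0 < e \<Longrightarrow> \<exists>u v. u < x \<and> x < v \<and> v - u < e \<and> T u v"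
  by (simp add: finely_covered_def)

text \<open>
  On a piece of \<open>E\<close> of diameter less than the \<open>\<delta>\<close> that belongs to \<open>\<epsilon> = 1\<close>, a finite covering by
  intervals of slope at least \<open>M\<close> gives \<open>M\<close> times half the measure of the piece as a lower bound for a
  sum of increments smaller than \<open>1\<close>.
\<close>

lemma null_if_unbounded_quotients:
  assumes AC: "abs_continuous_on_Icc a b G" and E: "E \<in> lmeasurable" "E \<subseteq> {a<..<b}"
    and unb: "\<And>x e M. x \<in> E \<Longrightarrow> 0 < e \<Longrightarrow>
      \<exists>u v. u < x \<and> x < v \<and> v - u < e \<and> real M * (v - u) \<le> \<bar>G v - G u\<bar>"
  shows "negligible E"
proof -
  obtain \<delta> where \<delta>: "0 < \<delta>" "\<And>P. finite P \<Longrightarrow> nonoverlapping P \<Longrightarrow>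
      (\<And>u v. (u, v) \<in> P \<Longrightarrow> a \<le> u \<and> u \<le> v \<and> v \<le> b) \<Longrightarrow>
      (\<Sum>(u, v)\<in>P. v - u) < \<delta> \<Longrightarrow> (\<Sum>(u, v)\<in>P. \<bar>G v - G u\<bar>) < 1"
    using abs_continuous_on_IccE[OF AC zero_less_one] by metis
  have null: "negligible (E \<inter> {y - \<delta> / 4<..<y + \<delta> / 4})" for y
  proof -
    let ?W = "{y - \<delta> / 4<..<y + \<delta> / 4}"
    let ?S = "E \<inter> ?W"
    let ?U = "{a<..<b} \<inter> ?W"
    have S: "?S \<in> lmeasurable" using E by auto
    have U: "open ?U" "?S \<subseteq> ?U" using E by auto
    have bound: "real M * (measure lebesgue ?S / 2) \<le> 1" if pos: "0 < measure lebesgue ?S" for M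
    proof -
      have half: "0 < measure lebesgue ?S / 2" using pos by simp
      have "\<exists>u v. u < x \<and> x < v \<and> v - u < e \<and> real M * (v - u) \<le> \<bar>G v - G u\<bar>"
        if "x \<in> ?S" "0 < e" for x e using unb that by blast
      from this obtain P where P: "finite P" "nonoverlapping P"
        "\<And>u v. (u, v) \<in> P \<Longrightarrow> u < v \<and> {u..v} \<subseteq> ?U \<and> real M * (v - u) \<le> \<bar>G v - G u\<bar>"
        "measure lebesgue (?S - (\<Union>(u, v)\<in>P. {u<..<v})) < measure lebesgue ?S / 2"
        by (rule Vitali_finite_intervals[OF S U _ half, of "\<lambda>u v. real M * (v - u) \<le> \<bar>G v - G u\<bar>"])
          (assumption+, rule that)
      let ?V = "\<Union>(u, v)\<in>P. {u<..<v}"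
      have Vl: "?V \<in> lmeasurable" using P(1) by (intro fmeasurable.finite_UN) auto
      have sum: "measure lebesgue ?V = (\<Sum>(u, v)\<in>P. v - u)"
        using P by (intro measure_nonoverlapping_Union) (auto simp: less_imp_le)
      have sub: "u \<in> ?U" "v \<in> ?U" "u < v" if "(u, v) \<in> P" for u v
        using P(3)[OF that] atLeastAtMost_iff[of u u v] atLeastAtMost_iff[of v u v]
        by (meson less_imp_le order_refl subsetD)+
      have "measure lebesgue ?V \<le> measure lebesgue ?W"
        using Vl sub by (intro measure_mono_fmeasurable) (fastforce simp: fmeasurableD)+
      then have "(\<Sum>(u, v)\<in>P. v - u) < \<delta>" unfolding sum using \<delta> by simp
      then have "(\<Sum>(u, v)\<in>P. \<bar>G v - G u\<bar>) < 1"
        using sub by (intro \<delta>(2) P) fastforce+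
      moreover have "real M * (\<Sum>(u, v)\<in>P. v - u) \<le> (\<Sum>(u, v)\<in>P. \<bar>G v - G u\<bar>)"
        using P(3) unfolding sum_distrib_left by (intro sum_mono) auto
      moreover have "measure lebesgue ?S / 2 \<le> (\<Sum>(u, v)\<in>P. v - u)"
      proof -
        have "measure lebesgue ?S \<le> measure lebesgue ((?S - ?V) \<union> ?V)"
          using S Vl by (intro measure_mono_fmeasurable) auto
        also have "\<dots> \<le> measure lebesgue (?S - ?V) + measure lebesgue ?V"
          using S Vl by (intro measure_Un_le) (auto simp: fmeasurableD)
        finally show ?thesis using P(4) unfolding sum by simp
      qed
      ultimately show ?thesis
        by (smt (verit) mult_left_mono of_nat_0_le_iff)
    qed
    have "measure lebesgue ?S = 0"
    proof (rule ccontr)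
      assume "measure lebesgue ?S \<noteq> 0"
      then have pos: "0 < measure lebesgue ?S" by (simp add: zero_less_measure_iff)
      obtain M where "2 / measure lebesgue ?S < real M" using reals_Archimedean2 by blast
      then show False using bound[OF pos, of M] pos by (simp add: field_simps)
    qed
    then show ?thesis using S by (simp add: negligible_iff_measure)
  qed
  then show ?thesis
    unfolding locally_negligible_alt[of E]
  proof (intro ballI)
    fix y assume "y \<in> E"
    then show "\<exists>U. openin (top_of_set E) U \<and> y \<in> U \<and> negligible U"
      using \<delta>(1) null[of y] by (intro exI[of _ "E \<inter> {y - \<delta> / 4<..<y + \<delta> / 4}"]) auto
  qed
qed

lemma abs_continuous_on_Icc_subinterval:
  assumes "abs_continuous_on_Icc a b F" "a \<le> c" "d \<le> b"
  shows "abs_continuous_on_Icc c d F"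
  unfolding abs_continuous_on_Icc_def
proof (intro allI impI)
  fix \<epsilon> :: real assume "0 < \<epsilon>"
  then obtain \<delta> where \<delta>: "0 < \<delta>" "\<And>P. finite P \<Longrightarrow> nonoverlapping P \<Longrightarrow>
      (\<And>u v. (u, v) \<in> P \<Longrightarrow> a \<le> u \<and> u \<le> v \<and> v \<le> b) \<Longrightarrow>
      (\<Sum>(u, v)\<in>P. v - u) < \<delta> \<Longrightarrow> (\<Sum>(u, v)\<in>P. \<bar>F v - F u\<bar>) < \<epsilon>"
    using abs_continuous_on_IccE[OF assms(1)] by metis
  show "\<exists>\<delta>>0. \<forall>P. finite P \<longrightarrow> (\<forall>(u, v)\<in>P. c \<le> u \<and> u \<le> v \<and> v \<le> d) \<longrightarrow>
       disjoint_family_on (\<lambda>(u, v). {u<..<v}) P \<longrightarrow>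
       (\<Sum>(u, v)\<in>P. v - u) < \<delta> \<longrightarrow> (\<Sum>(u, v)\<in>P. \<bar>F v - F u\<bar>) < \<epsilon>"
  proof (intro exI[of _ \<delta>] conjI allI impI \<delta>)
    fix P and u v :: real
    assume "\<forall>(u, v)\<in>P. c \<le> u \<and> u \<le> v \<and> v \<le> d" "(u, v) \<in> P"
    then have "c \<le> u \<and> u \<le> v \<and> v \<le> d" by blast
    then show "a \<le> u" "u \<le> v" "v \<le> b" using assms by auto
  qed (auto simp: nonoverlapping_def)
qed

lemma abs_continuous_if_increments_bounded:
  assumes AC: "abs_continuous_on_Icc a b g"
    and inc: "\<And>u v. a \<le> u \<Longrightarrow> u \<le> v \<Longrightarrow> v \<le> b \<Longrightarrow> \<bar>\<phi> v - \<phi> u\<bar> \<le> L * (\<bar>g v - g u\<bar> + (v - u))"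
  shows "abs_continuous_on_Icc a b \<phi>"
  unfolding abs_continuous_on_Icc_def
proof (intro allI impI)
  fix \<epsilon> :: real assume "0 < \<epsilon>"
  define \<eta> where "\<eta> = \<epsilon> / (2 * (\<bar>L\<bar> + 1))"
  have \<eta>: "0 < \<eta>" "2 * \<eta> * (\<bar>L\<bar> + 1) = \<epsilon>" using \<open>0 < \<epsilon>\<close> by (auto simp: \<eta>_def field_simps)
  obtain \<delta> where \<delta>: "0 < \<delta>" "\<And>P. finite P \<Longrightarrow> nonoverlapping P \<Longrightarrow>
      (\<And>u v. (u, v) \<in> P \<Longrightarrow> a \<le> u \<and> u \<le> v \<and> v \<le> b) \<Longrightarrow>
      (\<Sum>(u, v)\<in>P. v - u) < \<delta> \<Longrightarrow> (\<Sum>(u, v)\<in>P. \<bar>g v - g u\<bar>) < \<eta>"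
    using abs_continuous_on_IccE[OF AC \<eta>(1)] by metis
  show "\<exists>\<delta>>0. \<forall>P. finite P \<longrightarrow> (\<forall>(u, v)\<in>P. a \<le> u \<and> u \<le> v \<and> v \<le> b) \<longrightarrow>
       disjoint_family_on (\<lambda>(u, v). {u<..<v}) P \<longrightarrow>
       (\<Sum>(u, v)\<in>P. v - u) < \<delta> \<longrightarrow> (\<Sum>(u, v)\<in>P. \<bar>\<phi> v - \<phi> u\<bar>) < \<epsilon>"
  proof (intro exI[of _ "min \<delta> \<eta>"] conjI allI impI)
    show "0 < min \<delta> \<eta>" using \<delta> \<eta> by simp
    fix P assume P: "finite P" "\<forall>(u, v)\<in>P. a \<le> u \<and> u \<le> v \<and> v \<le> b"
      "disjoint_family_on (\<lambda>(u, v). {u<..<v}) P" "(\<Sum>(u, v)\<in>P. v - u) < min \<delta> \<eta>"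
    have sub: "a \<le> u \<and> u \<le> v \<and> v \<le> b" if "(u, v) \<in> P" for u v using P(2) that by blast
    have g: "(\<Sum>(u, v)\<in>P. \<bar>g v - g u\<bar>) < \<eta>"
      using P sub by (intro \<delta>(2)) (auto simp: nonoverlapping_def)
    have "(\<Sum>(u, v)\<in>P. \<bar>\<phi> v - \<phi> u\<bar>) \<le> (\<Sum>(u, v)\<in>P. \<bar>L\<bar> * (\<bar>g v - g u\<bar> + (v - u)))"
    proof (rule sum_mono, clarify)
      fix u v assume "(u, v) \<in> P"
      note uv = sub[OF this]
      have "\<bar>\<phi> v - \<phi> u\<bar> \<le> L * (\<bar>g v - g u\<bar> + (v - u))" using inc uv by blast
      also have "\<dots> \<le> \<bar>L\<bar> * (\<bar>g v - g u\<bar> + (v - u))"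
        using uv by (intro mult_right_mono) auto
      finally show "\<bar>\<phi> v - \<phi> u\<bar> \<le> \<bar>L\<bar> * (\<bar>g v - g u\<bar> + (v - u))" .
    qed
    also have "\<dots> = \<bar>L\<bar> * ((\<Sum>(u, v)\<in>P. \<bar>g v - g u\<bar>) + (\<Sum>(u, v)\<in>P. v - u))"
      by (simp add: sum_distrib_left sum.distrib[symmetric] case_prod_beta)
    also have "\<dots> \<le> \<bar>L\<bar> * (2 * \<eta>)"
      using g P(4) by (intro mult_left_mono) auto
    also have "\<dots> < \<epsilon>" using \<eta> by (simp add: algebra_simps)
    finally show "(\<Sum>(u, v)\<in>P. \<bar>\<phi> v - \<phi> u\<bar>) < \<epsilon>" .
  qed
qed

lemma locally_abs_continuous_Icc:
  assumes "locally_abs_continuous F"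
  shows "abs_continuous_on_Icc a b F"
proof (rule abs_continuous_on_Icc_subinterval)
  show "abs_continuous_on_Icc a (max b (a + 1)) F"
    using assms unfolding locally_abs_continuous_def by auto
qed auto

lemma abs_continuous_imp_continuous_on:
  assumes "abs_continuous_on_Icc a b F"
  shows "continuous_on {a..b} F"
  unfolding continuous_on_iff
proof (intro ballI allI impI)
  fix x and \<epsilon> :: real assume x: "x \<in> {a..b}" and "0 < \<epsilon>"
  then obtain \<delta> where \<delta>: "0 < \<delta>" "\<And>P. finite P \<Longrightarrow> nonoverlapping P \<Longrightarrow>
      (\<And>u v. (u, v) \<in> P \<Longrightarrow> a \<le> u \<and> u \<le> v \<and> v \<le> b) \<Longrightarrow>
      (\<Sum>(u, v)\<in>P. v - u) < \<delta> \<Longrightarrow> (\<Sum>(u, v)\<in>P. \<bar>F v - F u\<bar>) < \<epsilon>"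
    using abs_continuous_on_IccE[OF assms] by metis
  have "dist (F y) (F x) < \<epsilon>" if "y \<in> {a..b}" "dist y x < \<delta>" for y
  proof -
    have "(\<Sum>(u, v)\<in>{(min x y, max x y)}. \<bar>F v - F u\<bar>) < \<epsilon>"
    proof (rule \<delta>(2))
      show "nonoverlapping {(min x y, max x y)}" by (rule nonoverlappingI) auto
      show "(\<Sum>(u, v)\<in>{(min x y, max x y)}. v - u) < \<delta>" using that by (simp add: dist_real_def)
    qed (use that x in auto)
    then show ?thesis by (cases "x \<le> y") (simp_all add: dist_real_def min_def max_def abs_minus_commute)
  qed
  then show "\<exists>d>0. \<forall>x'\<in>{a..b}. dist x' x < d \<longrightarrow> dist (F x') (F x) < \<epsilon>" using \<delta>(1) by blast
qed

lemma locally_abs_continuous_isCont: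
  assumes "locally_abs_continuous F"
  shows "isCont F x"
proof -
  have "continuous_on {x - 1..x + 1} F"
    by (intro abs_continuous_imp_continuous_on locally_abs_continuous_Icc assms)
  then show ?thesis by (rule continuous_on_interior) simp
qed

lemma locally_abs_continuous_diff_linear:
  assumes "locally_abs_continuous F"
  shows "locally_abs_continuous (\<lambda>x. F x - c * x)"
  unfolding locally_abs_continuous_def
proof (intro allI impI)
  fix a b :: real
  show "abs_continuous_on_Icc a b (\<lambda>x. F x - c * x)"
  proof (rule abs_continuous_if_increments_bounded[OF locally_abs_continuous_Icc[OF assms]])
    fix u v :: real assume "u \<le> v"
    have "\<bar>(F v - c * v) - (F u - c * u)\<bar> = \<bar>(F v - F u) - c * (v - u)\<bar>" by (simp add: algebra_simps)
    also have "\<dots> \<le> \<bar>F v - F u\<bar> + \<bar>c * (v - u)\<bar>" by (rule abs_triangle_ineq4)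
    also have "\<bar>c * (v - u)\<bar> = \<bar>c\<bar> * (v - u)" using \<open>u \<le> v\<close> by (simp add: abs_mult)
    also have "\<bar>F v - F u\<bar> + \<bar>c\<bar> * (v - u) \<le> (1 + \<bar>c\<bar>) * (\<bar>F v - F u\<bar> + (v - u))"
      using \<open>u \<le> v\<close> by (simp add: distrib_left distrib_right)
    finally show "\<bar>(F v - c * v) - (F u - c * u)\<bar> \<le> (1 + \<bar>c\<bar>) * (\<bar>F v - F u\<bar> + (v - u))" .
  qed
qed

text \<open>
  A difference quotient based at \<open>x\<close> can be perturbed to one over an interval with \<open>x\<close> in its interior.
\<close>

lemma enlarged_interval:
  fixes G :: "real \<Rightarrow> real"
  assumes "\<And>x. isCont G x" "x \<noteq> y" "eventually T (nhds ((G y - G x) / (y - x)))" "\<bar>y - x\<bar> < e"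
  shows "\<exists>u v. u < x \<and> x < v \<and> v - u < e \<and> T ((G v - G u) / (v - u))"
proof -
  have 1: "((\<lambda>s. (G (max x y + s) - G (min x y - s)) / (\<bar>y - x\<bar> + 2 * s)) \<longlongrightarrow>
      (G (max x y + 0) - G (min x y - 0)) / (\<bar>y - x\<bar> + 2 * 0)) (at_right 0)"
    using assms(2) by (intro tendsto_intros isCont_tendsto_compose[OF assms(1)]) auto
  have "(G (max x y + 0) - G (min x y - 0)) / (\<bar>y - x\<bar> + 2 * 0) = (G y - G x) / (y - x)"
    using assms(2) by (auto simp: max_def min_def abs_if field_simps)
  then have "eventually (\<lambda>s. T ((G (max x y + s) - G (min x y - s)) / (\<bar>y - x\<bar> + 2 * s))) (at_right 0)"
    using 1 assms(3) by (simp add: filterlim_iff)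
  moreover have "eventually (\<lambda>s. 0 < s) (at_right (0 :: real))" by (simp add: eventually_at_right_less)
  moreover have "eventually (\<lambda>s. s < (e - \<bar>y - x\<bar>) / 2) (at_right (0 :: real))"
    using assms(4) by (intro eventually_at_right_field[THEN iffD2]) (auto intro!: exI[of _ "(e - \<bar>y - x\<bar>) / 2"])
  ultimately have "eventually (\<lambda>s. T ((G (max x y + s) - G (min x y - s)) / (\<bar>y - x\<bar> + 2 * s)) \<and> 0 < s \<and>
     s < (e - \<bar>y - x\<bar>) / 2) (at_right 0)" by eventually_elim auto
  then obtain s where s: "T ((G (max x y + s) - G (min x y - s)) / (\<bar>y - x\<bar> + 2 * s))" "0 < s"
     "s < (e - \<bar>y - x\<bar>) / 2"
    by (metis (mono_tags, lifting) eventually_happens trivial_limit_at_right_real)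
  have eq: "max x y + s - (min x y - s) = \<bar>y - x\<bar> + 2 * s" by auto
  show ?thesis
    by (rule exI[of _ "min x y - s"], rule exI[of _ "max x y + s"], unfold eq) (use s in auto)
qed

text \<open>
  At a point of non-differentiability the quotients are unbounded, or they lie frequently below
  \<open>\<alpha>\<close> and frequently above \<open>\<beta>\<close> for some rationals \<open>\<alpha> < \<beta>\<close>.  The second case is reduced to the lemma
  on oscillating quotients by subtracting \<open>\<alpha> x\<close>.
\<close>

theorem locally_abs_continuous_differentiable_AE:
  assumes AC: "locally_abs_continuous G"
  shows "AE x in lebesgue. G differentiable (at x)"
proof -
  define E where "E \<alpha> \<beta> = finely_covered (\<lambda>u v. (G v - G u) / (v - u) < real_of_rat \<alpha>) \<inter>
    finely_covered (\<lambda>u v. (G v - G u) / (v - u) > real_of_rat \<beta>)" for \<alpha> \<beta>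
  define I where "I = (\<Inter>M. finely_covered (\<lambda>u v. \<bar>(G v - G u) / (v - u)\<bar> > real M))"
  have cont: "isCont G x" for x using AC by (rule locally_abs_continuous_isCont)
  have nE: "negligible (E \<alpha> \<beta>)" if "\<alpha> < \<beta>" for \<alpha> \<beta>
  proof (rule negligible_on_intervals[THEN iffD2], intro allI)
    fix a b :: real
    let ?S = "E \<alpha> \<beta> \<inter> {a<..<b}"
    let ?G = "\<lambda>x. G x - real_of_rat \<alpha> * x"
    have "?S \<in> sets lebesgue" unfolding E_def by (intro sets.Int finely_covered_sets) auto
    then have S: "?S \<in> lmeasurable" by (intro bounded_set_imp_lmeasurable) auto
    have "measure lebesgue ?S = 0"
    proof (rule null_if_oscillating_quotients[OF _ S])
      show "abs_continuous_on_Icc a b ?G"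
        by (intro locally_abs_continuous_Icc locally_abs_continuous_diff_linear AC)
      show "0 < real_of_rat (\<beta> - \<alpha>)" using that by simp
      fix x e :: real assume x: "x \<in> ?S" and e: "0 < e"
      obtain u v where "u < x \<and> x < v \<and> v - u < e \<and> (G v - G u) / (v - u) < real_of_rat \<alpha>"
        using x finely_coveredD[OF _ e] unfolding E_def by blast
      then show "\<exists>u v. u < x \<and> x < v \<and> v - u < e \<and> ?G v - ?G u \<le> 0"
        by (intro exI[of _ u] exI[of _ v]) (auto simp: field_simps)
      obtain u v where "u < x \<and> x < v \<and> v - u < e \<and> (G v - G u) / (v - u) > real_of_rat \<beta>"
        using x finely_coveredD[OF _ e] unfolding E_def by blast
      then show "\<exists>u v. u < x \<and> x < v \<and> v - u < e \<and> real_of_rat (\<beta> - \<alpha>) * (v - u) \<le> ?G v - ?G u"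
        by (intro exI[of _ u] exI[of _ v]) (auto simp: field_simps of_rat_diff)
    qed auto
    then have "negligible ?S" using S by (simp add: negligible_iff_measure)
    then have "negligible (?S \<union> {a, b})" by (simp add: negligible_Un)
    then show "negligible (E \<alpha> \<beta> \<inter> cbox a b)" by (rule negligible_subset) auto
  qed
  have nI: "negligible I"
  proof (rule negligible_on_intervals[THEN iffD2], intro allI)
    fix a b :: real
    let ?S = "I \<inter> {a<..<b}"
    have "I \<in> sets lebesgue"
      unfolding I_def by (intro sets.countable_INT'' finely_covered_sets) simp_all
    then have "?S \<in> sets lebesgue" by (rule sets.Int) simp
    moreover have "bounded ?S" by (rule bounded_subset[OF bounded_box[of a b]]) auto
    ultimately have S: "?S \<in> lmeasurable" by (rule bounded_set_imp_lmeasurable[rotated])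
    have "negligible ?S"
    proof (rule null_if_unbounded_quotients[OF locally_abs_continuous_Icc[OF AC] S])
      fix x e :: real and M assume x: "x \<in> ?S" and e: "0 < e"
      have "x \<in> finely_covered (\<lambda>u v. \<bar>(G v - G u) / (v - u)\<bar> > real M)"
        using x by (simp add: I_def)
      from finely_coveredD[OF this e] obtain u v
        where "u < x \<and> x < v \<and> v - u < e \<and> \<bar>(G v - G u) / (v - u)\<bar> > real M"
        by (elim exE)
      then show "\<exists>u v. u < x \<and> x < v \<and> v - u < e \<and> real M * (v - u) \<le> \<bar>G v - G u\<bar>"
        by (intro exI[of _ u] exI[of _ v]) (auto simp: field_simps)
    qed auto
    then have "negligible (?S \<union> {a, b})" by (simp add: negligible_Un)
    then show "negligible (I \<inter> cbox a b)" by (rule negligible_subset) auto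
  qed
  let ?N = "I \<union> (\<Union>(\<alpha>, \<beta>)\<in>{(\<alpha>, \<beta>). \<alpha> < \<beta>}. E \<alpha> \<beta>)"
  have null: "negligible ?N"
    using nI nE by (intro negligible_Un negligible_countable_Union countable_image) auto
  have diff: "G differentiable (at x)" if x: "x \<notin> ?N" for x
  proof -
    define q where "q y = (G y - G x) / (y - x)" for y
    have fine: "x \<in> finely_covered (\<lambda>u v. T ((G v - G u) / (v - u)))"
      if frq: "frequently (\<lambda>y. eventually T (nhds (q y))) (at x)" for T
      unfolding finely_covered_def
    proof (intro CollectI allI impI)
      fix e :: real assume e: "0 < e"
      have "eventually (\<lambda>y. \<bar>y - x\<bar> < e) (at x)"
        using e by (auto simp: eventually_at dist_real_def)
      moreover have "eventually (\<lambda>y. x \<noteq> y) (at x)"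
        by (auto simp: eventually_at_filter)
      ultimately have "eventually (\<lambda>y. \<bar>y - x\<bar> < e \<and> x \<noteq> y) (at x)" by (rule eventually_conj)
      from frequently_ex[OF frequently_eventually_conj[OF frq this]]
      obtain y where "\<bar>y - x\<bar> < e" "x \<noteq> y" "eventually T (nhds (q y))" by (elim exE conjE)
      then show "\<exists>u v. u < x \<and> x < v \<and> v - u < e \<and> T ((G v - G u) / (v - u))"
        unfolding q_def by (intro enlarged_interval[OF cont]) auto
    qed
    let ?q = "\<lambda>y. ereal (q y)"
    have "x \<notin> I" using x by blast
    then have "\<exists>M. x \<notin> finely_covered (\<lambda>u v. \<bar>(G v - G u) / (v - u)\<bar> > real M)"
      by (simp add: I_def)
    then obtain M where M: "x \<notin> finely_covered (\<lambda>u v. \<bar>(G v - G u) / (v - u)\<bar> > real M)"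
      by (elim exE)
    have bdd: "eventually (\<lambda>y. \<bar>q y\<bar> \<le> real M) (at x)"
    proof (rule ccontr)
      assume "\<not> ?thesis"
      then have "frequently (\<lambda>y. real M < \<bar>q y\<bar>) (at x)" by (simp add: frequently_def not_less)
      then have "frequently (\<lambda>y. eventually (\<lambda>z. real M < \<bar>z\<bar>) (nhds (q y))) (at x)"
      proof (rule frequently_elim1)
        have "open {z :: real. real M < \<bar>z\<bar>}" by (intro open_Collect_less continuous_intros)
        then show "eventually (\<lambda>z. real M < \<bar>z\<bar>) (nhds (q y))" if "real M < \<bar>q y\<bar>" for y
          using eventually_nhds_in_open[of "{z. real M < \<bar>z\<bar>}" "q y"] that by simp
      qed
      from fine[OF this] M show False by contradiction
    qed
    have "Limsup (at x) ?q \<le> Liminf (at x) ?q"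
    proof (rule ccontr)
      assume "\<not> ?thesis"
      then have "Liminf (at x) ?q < Limsup (at x) ?q" by simp
      then obtain r where r: "Liminf (at x) ?q < ereal r" "ereal r < Limsup (at x) ?q"
        using ereal_dense2 by blast
      obtain s where s: "ereal r < ereal s" "ereal s < Limsup (at x) ?q"
        using ereal_dense2[OF r(2)] by blast
      then obtain \<alpha> where \<alpha>: "r < real_of_rat \<alpha>" "real_of_rat \<alpha> < s" using of_rat_dense by auto
      then obtain \<beta> where \<beta>: "real_of_rat \<alpha> < real_of_rat \<beta>" "real_of_rat \<beta> < s" using of_rat_dense by blast
      have "frequently (\<lambda>y. q y < real_of_rat \<alpha>) (at x)"
      proof (rule ccontr)
        assume "\<not> ?thesis"
        then have "ereal (real_of_rat \<alpha>) \<le> Liminf (at x) ?q"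
          by (intro Liminf_bounded) (simp add: frequently_def not_less)
        then show False using r(1) \<alpha>(1) by (metis ereal_less_eq(3) less_imp_le not_less order_trans)
      qed
      then have "frequently (\<lambda>y. eventually (\<lambda>z. z < real_of_rat \<alpha>) (nhds (q y))) (at x)"
      proof (rule frequently_elim1)
        show "eventually (\<lambda>z. z < real_of_rat \<alpha>) (nhds (q y))" if "q y < real_of_rat \<alpha>" for y
          using eventually_nhds_in_open[of "{..<real_of_rat \<alpha>}" "q y"] that by simp
      qed
      moreover
      have "frequently (\<lambda>y. q y > real_of_rat \<beta>) (at x)"
      proof (rule ccontr)
        assume "\<not> ?thesis"
        then have "Limsup (at x) ?q \<le> ereal (real_of_rat \<beta>)"
          by (intro Limsup_bounded) (simp add: frequently_def not_less)
        then show False using s(2) \<beta>(2) by (metis ereal_less_eq(3) less_imp_le not_less order_trans)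
      qed
      then have "frequently (\<lambda>y. eventually (\<lambda>z. z > real_of_rat \<beta>) (nhds (q y))) (at x)"
      proof (rule frequently_elim1)
        show "eventually (\<lambda>z. z > real_of_rat \<beta>) (nhds (q y))" if "q y > real_of_rat \<beta>" for y
          using eventually_nhds_in_open[of "{real_of_rat \<beta><..}" "q y"] that by simp
      qed
      ultimately have "x \<in> E \<alpha> \<beta>" unfolding E_def by (intro IntI fine)
      moreover have "\<alpha> < \<beta>" using \<beta>(1) by (simp add: of_rat_less)
      ultimately show False using x by blast
    qed
    moreover have "Liminf (at x) ?q \<le> Limsup (at x) ?q" by (simp add: Liminf_le_Limsup)
    ultimately have lim: "(?q \<longlongrightarrow> Limsup (at x) ?q) (at x)"
      by (intro tendsto_Limsup) auto
    have "Limsup (at x) ?q \<le> ereal (real M)"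
      using bdd by (intro Limsup_bounded) (auto elim: eventually_mono)
    moreover have "ereal (- real M) \<le> Limsup (at x) ?q"
      using bdd by (intro order_trans[OF Liminf_bounded Liminf_le_Limsup]) (auto elim: eventually_mono)
    ultimately obtain D where "Limsup (at x) ?q = ereal D"
      by (cases "Limsup (at x) ?q") auto
    then have "(q \<longlongrightarrow> D) (at x)" using lim by simp
    then show ?thesis
      unfolding real_differentiable_def has_field_derivative_iff q_def by blast
  qed
  show ?thesis
    by (rule AE_I'[OF null[unfolded negligible_iff_null_sets]]) (use diff in blast)
qed

section \<open>The fundamental theorem of calculus for absolutely continuous functions\<close>

text \<open>
  This is proved for the gauge integral, where integrability of the derivative is part of the
  conclusion.  Intervals tagged outside \<open>N\<close> are controlled by the derivative at the tag; those tagged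
  in \<open>N\<close> lie in an open set of small measure and are controlled by absolute continuity.
\<close>

theorem abs_continuous_has_integral:
  assumes AC: "abs_continuous_on_Icc a b F" and ab: "a \<le> b" and N: "negligible N"
    and deriv: "\<And>x. x \<in> {a..b} - N \<Longrightarrow> (F has_real_derivative F' x) (at x)"
  shows "(F' has_integral F b - F a) {a..b}"
proof (rule has_integral_spike[OF N, of _ _ "\<lambda>x. if x \<in> N then 0 else F' x"])
  let ?D = "\<lambda>x. if x \<in> N then 0 else F' x"
  show "(?D has_integral F b - F a) {a..b}"
    unfolding has_integral_real
  proof (intro allI impI)
    fix e :: real assume e: "0 < e"
    define \<eta> where "\<eta> = e / (2 * (b - a + 1))"
    have \<eta>: "0 < \<eta>" "\<eta> * (b - a) < e / 2"
      using e ab by (auto simp: \<eta>_def field_simps)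
    obtain \<delta> where \<delta>: "0 < \<delta>" "\<And>P. finite P \<Longrightarrow> nonoverlapping P \<Longrightarrow>
      (\<And>u v. (u, v) \<in> P \<Longrightarrow> a \<le> u \<and> u \<le> v \<and> v \<le> b) \<Longrightarrow>
      (\<Sum>(u, v)\<in>P. v - u) < \<delta> \<Longrightarrow> (\<Sum>(u, v)\<in>P. \<bar>F v - F u\<bar>) < e / 2"
      using abs_continuous_on_IccE[OF AC, of "e / 2"] e by (metis half_gt_zero)
    obtain U where U: "open U" "N \<subseteq> U" "U - N \<in> lmeasurable" "emeasure lebesgue (U - N) < ennreal \<delta>"
      using sets_lebesgue_outer_open[OF _ \<delta>(1)] N by (metis negligible_imp_sets)
    have Ul: "U \<in> lmeasurable"
    proof -
      have "(U - N) \<union> N \<in> lmeasurable"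
        using U(3) negligible_imp_measurable[OF N] by (rule fmeasurable.Un)
      then show ?thesis using U(2) by (simp add: Un_absorb2)
    qed
    have mU: "measure lebesgue U < \<delta>"
    proof -
      have "measure lebesgue U = measure lebesgue ((U - N) \<union> N)" using U(2) by (simp add: Un_absorb2)
      also have "\<dots> \<le> measure lebesgue (U - N) + measure lebesgue N"
        using U(3) negligible_imp_measurable[OF N] by (intro measure_Un_le) (auto simp: fmeasurableD)
      also have "measure lebesgue N = 0" using N by (rule negligible_imp_measure0)
      also have "measure lebesgue (U - N) < \<delta>"
        using U(3,4) \<delta>(1) by (simp add: emeasure_eq_measure2 ennreal_less_iff)
      finally show ?thesis by simp
    qed
    have "\<exists>d>0. \<forall>y. \<bar>y - x\<bar> < d \<longrightarrow> \<bar>F y - F x - F' x * (y - x)\<bar> \<le> \<eta> * \<bar>y - x\<bar>"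
      if x: "x \<in> {a..b} - N" for x
    proof -
      have "(F has_derivative (\<lambda>y. F' x * y)) (at x)"
        using deriv[OF x] by (simp add: has_field_derivative_def)
      then show ?thesis using \<eta>(1) unfolding has_derivative_at_alt by (simp add: mult.commute)
    qed
    then obtain d where d: "\<And>x. x \<in> {a..b} - N \<Longrightarrow> 0 < d x"
      "\<And>x y. x \<in> {a..b} - N \<Longrightarrow> \<bar>y - x\<bar> < d x \<Longrightarrow> \<bar>F y - F x - F' x * (y - x)\<bar> \<le> \<eta> * \<bar>y - x\<bar>"
      by metis
    define \<gamma> where "\<gamma> x = (if x \<in> N then U else if x \<in> {a..b} then ball x (d x) else UNIV)" for x
    show "\<exists>\<gamma>. gauge \<gamma> \<and> (\<forall>p. p tagged_division_of {a..b} \<and> \<gamma> fine p \<longrightarrow>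
        norm ((\<Sum>(x, K)\<in>p. measure lborel K *\<^sub>R ?D x) - (F b - F a)) < e)"
    proof (intro exI[of _ \<gamma>] conjI allI impI)
      show "gauge \<gamma>" using U d(1) by (auto simp: gauge_def \<gamma>_def)
      fix p assume "p tagged_division_of {a..b} \<and> \<gamma> fine p"
      then have p: "p tagged_division_of {a..b}" "\<gamma> fine p" by auto
      have fin: "finite p" using p(1) by (rule tagged_division_of_finite)
      have K: "\<exists>u v. K = {u..v} \<and> a \<le> u \<and> u \<le> x \<and> x \<le> v \<and> v \<le> b \<and> Inf K = u \<and> Sup K = v
          \<and> measure lborel K = v - u \<and> K \<subseteq> \<gamma> x"
        if "(x, K) \<in> p" for x K
      proof -
        obtain u v where "K = cbox u v" using tagged_division_ofD(4)[OF p(1) \<open>(x, K) \<in> p\<close>] by blast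
        moreover have "x \<in> K" "K \<subseteq> {a..b}" using tagged_division_ofD(2,3)[OF p(1) \<open>(x, K) \<in> p\<close>] by auto
        moreover have "K \<subseteq> \<gamma> x" using p(2) \<open>(x, K) \<in> p\<close> by (rule fineD)
        ultimately show ?thesis by (intro exI[of _ u] exI[of _ v]) auto
      qed
      define inc where "inc z = (case z of (x :: real, K) \<Rightarrow> F (Sup K) - F (Inf K))" for z
      define err where "err z = (case z of (x, K) \<Rightarrow> measure lborel K *\<^sub>R ?D x) - inc z" for z
      define p1 where "p1 = {z \<in> p. fst z \<notin> N}"
      define p2 where "p2 = {z \<in> p. fst z \<in> N}"
      have fin2: "finite p2" unfolding p2_def using fin by simp
      have "(\<Sum>(x, K)\<in>p. measure lborel K *\<^sub>R ?D x) - (F b - F a) = sum err p"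
        unfolding err_def sum_subtractf inc_def additive_tagged_division_1[OF ab p(1)] ..
      moreover have "\<bar>sum err p\<bar> \<le> (\<Sum>z\<in>p. \<bar>err z\<bar>)" by (rule sum_abs)
      moreover have "(\<Sum>z\<in>p. \<bar>err z\<bar>) = (\<Sum>z\<in>p1. \<bar>err z\<bar>) + (\<Sum>z\<in>p2. \<bar>err z\<bar>)"
        unfolding p1_def p2_def using fin
        by (subst sum.union_disjoint[symmetric]) (auto intro!: sum.cong)
      moreover have "(\<Sum>z\<in>p1. \<bar>err z\<bar>) < e / 2"
      proof -
        have "(\<Sum>z\<in>p1. \<bar>err z\<bar>) \<le> (\<Sum>(x, K)\<in>p1. \<eta> * (Sup K - Inf K))"
        proof (rule sum_mono, clarify)
          fix x K assume "(x, K) \<in> p1"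
          then have xK: "(x, K) \<in> p" "x \<notin> N" by (auto simp: p1_def)
          obtain u v where uv: "a \<le> u" "u \<le> x" "x \<le> v" "v \<le> b" "K = {u..v}" "Inf K = u" "Sup K = v"
            "measure lborel K = v - u" "K \<subseteq> \<gamma> x"
            using K[OF xK(1)] by blast
          have x: "x \<in> {a..b} - N" using uv xK by auto
          have "u \<in> K" "v \<in> K" using uv(2,3,5) by auto
          then have "u \<in> ball x (d x)" "v \<in> ball x (d x)" using uv(9) x by (auto simp: \<gamma>_def)
          then have "\<bar>u - x\<bar> < d x" "\<bar>v - x\<bar> < d x" by (auto simp: dist_real_def)
          then have 1: "\<bar>F u - F x - F' x * (u - x)\<bar> \<le> \<eta> * \<bar>u - x\<bar>"
            "\<bar>F v - F x - F' x * (v - x)\<bar> \<le> \<eta> * \<bar>v - x\<bar>" using d(2)[OF x] by auto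
          have "err (x, K) = (F u - F x - F' x * (u - x)) - (F v - F x - F' x * (v - x))"
            using xK uv by (simp add: err_def inc_def algebra_simps)
          then have "\<bar>err (x, K)\<bar> \<le> \<eta> * \<bar>u - x\<bar> + \<eta> * \<bar>v - x\<bar>" using 1 by linarith
          also have "\<dots> = \<eta> * (Sup K - Inf K)" using uv by (simp add: algebra_simps)
          finally show "\<bar>err (x, K)\<bar> \<le> \<eta> * (Sup K - Inf K)" .
        qed
        also have "\<dots> \<le> (\<Sum>(x, K)\<in>p. \<eta> * (Sup K - Inf K))"
        proof (rule sum_mono2[OF fin])
          show "0 \<le> (case z of (x, K) \<Rightarrow> \<eta> * (Sup K - Inf K))" if "z \<in> p - p1" for z
            using that K[of "fst z" "snd z"] \<eta>(1) by (auto simp: case_prod_beta)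
        qed (auto simp: p1_def)
        also have "\<dots> = \<eta> * (\<Sum>(x, K)\<in>p. Sup K - Inf K)"
          by (simp add: sum_distrib_left case_prod_beta)
        also have "(\<Sum>(x, K)\<in>p. Sup K - Inf K) = b - a"
          using additive_tagged_division_1[OF ab p(1), of "\<lambda>x. x"] by simp
        finally show ?thesis using \<eta>(2) by linarith
      qed
      moreover have "(\<Sum>z\<in>p2. \<bar>err z\<bar>) < e / 2"
      proof -
        \<comment> \<open>Degenerate intervals contribute nothing; without them, tags do not matter.\<close>
        define q where "q = {z \<in> p2. Inf (snd z) < Sup (snd z)}"
        define \<pi> where "\<pi> z = (Inf (snd z), Sup (snd z))" for z :: "real \<times> real set"
        have finq: "finite q" using fin2 by (simp add: q_def)
        have q: "\<exists>u v. K = {u..v} \<and> u < v \<and> a \<le> u \<and> v \<le> b \<and> \<pi> (x, K) = (u, v) \<and> {u..v} \<subseteq> U"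
          if "(x, K) \<in> q" for x K
        proof -
          have "(x, K) \<in> p" "x \<in> N" using that by (auto simp: q_def p2_def)
          then show ?thesis using K[of x K] that by (fastforce simp: q_def \<gamma>_def \<pi>_def)
        qed
        have same: "z = z'" if z: "z \<in> q" "z' \<in> q" and
          t: "fst (\<pi> z) < t" "t < snd (\<pi> z)" "fst (\<pi> z') < t" "t < snd (\<pi> z')" for z z' t
        proof (rule ccontr)
          assume ne: "z \<noteq> z'"
          obtain x K x' K' where [simp]: "z = (x, K)" "z' = (x', K')" by (metis surj_pair)
          have "(x, K) \<in> p" "(x', K') \<in> p" using z by (auto simp: q_def p2_def)
          then have "interior K \<inter> interior K' = {}" using tagged_division_ofD(5)[OF p(1)] ne by auto
          moreover have "t \<in> interior K" "t \<in> interior K'" using q[of x K] q[of x' K'] z t by auto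
          ultimately show False by blast
        qed
        have inj: "inj_on \<pi> q"
        proof (rule inj_onI)
          fix z z' assume z: "z \<in> q" "z' \<in> q" "\<pi> z = \<pi> z'"
          have "fst (\<pi> z) < snd (\<pi> z)" using z(1) by (simp add: \<pi>_def q_def)
          then obtain t where "fst (\<pi> z) < t" "t < snd (\<pi> z)" using dense by blast
          then show "z = z'" using same[OF z(1,2)] z(3) by simp
        qed
        have P: "finite (\<pi> ` q)" "nonoverlapping (\<pi> ` q)"
        proof -
          show "nonoverlapping (\<pi> ` q)"
          proof (rule nonoverlappingI)
            fix u v u' v' t assume *: "(u, v) \<in> \<pi> ` q" "(u', v') \<in> \<pi> ` q" "u < t" "t < v" "u' < t" "t < v'"
            then obtain z z' where z: "z \<in> q" "z' \<in> q" "\<pi> z = (u, v)" "\<pi> z' = (u', v')" by force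
            then have "z = z'" using same[of z z' t] * by simp
            then show "u = u' \<and> v = v'" using z by simp
          qed
        qed (use finq in simp)
        have sub: "u < v \<and> a \<le> u \<and> v \<le> b \<and> {u..v} \<subseteq> U" if uv: "(u, v) \<in> \<pi> ` q" for u v
        proof -
          obtain x K where "(x, K) \<in> q" "\<pi> (x, K) = (u, v)" using uv by force
          then show ?thesis using q[of x K] by auto
        qed
        have "(\<Sum>(u, v)\<in>\<pi> ` q. v - u) < \<delta>"
        proof -
          have "(\<Sum>(u, v)\<in>\<pi> ` q. v - u) = measure lebesgue (\<Union>(u, v)\<in>\<pi> ` q. {u<..<v})"
            using P sub by (intro measure_nonoverlapping_Union[symmetric]) (auto simp: less_imp_le)
          also have "\<dots> \<le> measure lebesgue U"
          proof (rule measure_mono_fmeasurable[OF _ _ Ul])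
            show "(\<Union>(u, v)\<in>\<pi> ` q. {u<..<v}) \<subseteq> U"
            proof
              fix t assume "t \<in> (\<Union>(u, v)\<in>\<pi> ` q. {u<..<v})"
              then obtain z where z: "z \<in> \<pi> ` q" "t \<in> (case z of (u, v) \<Rightarrow> {u<..<v})"
                by (elim UN_E)
              then have "{fst z..snd z} \<subseteq> U" using sub[of "fst z" "snd z"] by simp
              then show "t \<in> U" using z(2) by (auto simp: case_prod_beta)
            qed
            show "(\<Union>(u, v)\<in>\<pi> ` q. {u<..<v}) \<in> sets lebesgue"
              using P(1) by (intro sets.finite_UN) auto
          qed
          finally show ?thesis using mU by simp
        qed
        then have "(\<Sum>(u, v)\<in>\<pi> ` q. \<bar>F v - F u\<bar>) < e / 2"
          using sub by (intro \<delta>(2) P) (auto simp: less_imp_le)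
        also have "(\<Sum>(u, v)\<in>\<pi> ` q. \<bar>F v - F u\<bar>) = (\<Sum>z\<in>q. \<bar>err z\<bar>)"
          unfolding sum.reindex[OF inj]
          by (intro sum.cong) (auto simp: q_def p2_def \<pi>_def err_def inc_def)
        also have "\<dots> = (\<Sum>z\<in>p2. \<bar>err z\<bar>)"
        proof (rule sum.mono_neutral_left[OF fin2])
          show "\<forall>z\<in>p2 - q. \<bar>err z\<bar> = 0"
          proof
            fix z assume z: "z \<in> p2 - q"
            obtain x K where [simp]: "z = (x, K)" by fastforce
            have "(x, K) \<in> p" using z by (simp add: p2_def)
            then have "Inf K = Sup K" using K[of x K] z by (fastforce simp: q_def)
            then show "\<bar>err z\<bar> = 0" using z by (simp add: err_def inc_def p2_def)
          qed
        qed (auto simp: q_def)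
        finally show ?thesis .
      qed
      ultimately show "norm ((\<Sum>(x, K)\<in>p. measure lborel K *\<^sub>R ?D x) - (F b - F a)) < e"
        by (simp only: real_norm_def)
    qed
  qed
qed auto

section \<open>Zero sets, signed powers and compositions\<close>

text \<open>
  Such zeros are isolated.
\<close>

lemma negligible_zeros_with_nonzero_derivative:
  fixes F :: "real \<Rightarrow> real"
  shows "negligible {x. F x = 0 \<and> (\<exists>D. D \<noteq> 0 \<and> (F has_real_derivative D) (at x))}" (is "negligible ?S")
  unfolding negligible_eq_zero_density_alt
proof (intro ballI allI impI)
  fix x e :: real assume x: "x \<in> ?S" and e: "0 < e"
  then obtain D where D: "F x = 0" "D \<noteq> 0" "((\<lambda>y. (F y - F x) / (y - x)) \<longlongrightarrow> D) (at x)"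
    by (auto simp: has_field_derivative_iff)
  then have "eventually (\<lambda>y. (F y - F x) / (y - x) \<noteq> 0) (at x)"
    by (intro tendsto_imp_eventually_ne)
  then obtain r where r: "0 < r" "\<And>y. y \<noteq> x \<Longrightarrow> dist y x < r \<Longrightarrow> F y \<noteq> 0"
    using D(1) unfolding eventually_at by auto
  show "\<exists>d U. 0 < d \<and> d \<le> e \<and> ?S \<inter> ball x d \<subseteq> U \<and> U \<in> lmeasurable \<and>
      measure lebesgue U < e * measure lebesgue (ball x d)"
  proof (intro exI[of _ "min e r"] exI[of _ "{x}"] conjI)
    show "?S \<inter> ball x (min e r) \<subseteq> {x}"
    proof
      fix y assume "y \<in> ?S \<inter> ball x (min e r)"
      then have "F y = 0" "dist y x < r" by (auto simp: dist_commute)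
      then show "y \<in> {x}" using r(2)[of y] by auto
    qed
  qed (use e r(1) in \<open>auto simp: content_ball_pos negligible_imp_measurable\<close>)
qed

text \<open>
  The signed power \<open>|u|\<^sup>q sgn u\<close>, which for \<open>q = p - 1\<close> is \<open>|u|\<^sup>p\<^sup>-\<^sup>2 u\<close>.
\<close>

definition spow :: "real \<Rightarrow> real \<Rightarrow> real" where
  "spow q u = sgn u * \<bar>u\<bar> powr q"

text \<open>
  Its derivative, for \<open>q \<ge> 1\<close>.  The case \<open>q = 1\<close> is separate because \<open>0 powr 0 = 0\<close>, while the
  derivative at \<open>0\<close> of the identity is \<open>1\<close>.
\<close>

definition spow_deriv :: "real \<Rightarrow> real \<Rightarrow> real" where
  "spow_deriv q u = (if q = 1 then 1 else q * \<bar>u\<bar> powr (q - 1))"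

lemma spow_has_derivative:
  assumes "1 \<le> q"
  shows "(spow q has_real_derivative spow_deriv q u) (at u)"
proof (cases "q = 1")
  case True
  then have "spow q = (\<lambda>u. u)" by (auto simp: spow_def sgn_if)
  then show ?thesis using True by (simp add: spow_deriv_def)
next
  case q: False
  consider "0 < u" | "u < 0" | "u = 0" by linarith
  then show ?thesis
  proof cases
    case 1
    have "((\<lambda>u. u powr q) has_real_derivative q * u powr (q - 1)) (at u)"
      using 1 by (auto intro!: derivative_eq_intros)
    then have "((\<lambda>u. u powr q) has_real_derivative spow_deriv q u) (at u)"
      using 1 q by (simp add: spow_deriv_def)
    then show ?thesis
      by (rule has_field_derivative_transform_within_open[of _ _ _ "{0<..}"])
        (use 1 in \<open>auto simp: spow_def\<close>)
  next
    case 2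
    have "((\<lambda>u. - ((- u) powr q)) has_real_derivative q * (- u) powr (q - 1)) (at u)"
      using 2 by (auto intro!: derivative_eq_intros)
    then have "((\<lambda>u. - ((- u) powr q)) has_real_derivative spow_deriv q u) (at u)"
      using 2 q by (simp add: spow_deriv_def)
    then show ?thesis
      by (rule has_field_derivative_transform_within_open[of _ _ _ "{..<0}"])
        (use 2 in \<open>auto simp: spow_def\<close>)
  next
    case 3
    have "((\<lambda>y. \<bar>y\<bar> powr (q - 1)) \<longlongrightarrow> \<bar>0\<bar> powr (q - 1)) (at (0 :: real))"
      using q assms by (intro tendsto_powr' tendsto_intros) auto
    then have "((\<lambda>y. \<bar>y\<bar> powr (q - 1)) \<longlongrightarrow> 0) (at (0 :: real))" by simp
    then have "((\<lambda>y. (spow q y - spow q 0) / (y - 0)) \<longlongrightarrow> 0) (at (0 :: real))"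
    proof (rule Lim_transform_eventually)
      have "\<bar>y\<bar> powr (q - 1) = (spow q y - spow q 0) / (y - 0)" if "y \<noteq> 0" for y
        using that by (auto simp: spow_def sgn_if powr_diff)
      then show "eventually (\<lambda>y. \<bar>y\<bar> powr (q - 1) = (spow q y - spow q 0) / (y - 0)) (at 0)"
        by (simp add: eventually_at_filter)
    qed
    then show ?thesis using 3 q by (simp add: has_field_derivative_iff spow_deriv_def)
  qed
qed

lemma continuous_spow_deriv: "1 \<le> q \<Longrightarrow> continuous_on A (spow_deriv q)"
  unfolding spow_deriv_def[abs_def]
  by (cases "q = 1") (auto intro!: continuous_intros continuous_on_powr')

lemma abs_spow: "\<bar>spow q u\<bar> = \<bar>u\<bar> powr q"
  by (simp add: spow_def abs_mult sgn_if)

lemma spow_mult: "spow (p - 1) u * u = \<bar>u\<bar> powr p"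
  by (cases "u = 0") (auto simp: spow_def sgn_if powr_diff)

lemma Lipschitz_on_Icc_if_C1:
  fixes \<psi> :: "real \<Rightarrow> real"
  assumes "\<And>x. (\<psi> has_real_derivative \<psi>' x) (at x)" "continuous_on UNIV \<psi>'"
  obtains L where "0 \<le> L" "\<And>u v. u \<in> {c..d} \<Longrightarrow> v \<in> {c..d} \<Longrightarrow> \<bar>\<psi> v - \<psi> u\<bar> \<le> L * \<bar>v - u\<bar>"
proof -
  have "compact (\<psi>' ` {c..d})"
    by (intro compact_continuous_image continuous_on_subset[OF assms(2)]) auto
  then obtain B where B: "0 < B" "\<And>x. x \<in> {c..d} \<Longrightarrow> \<bar>\<psi>' x\<bar> \<le> B"
    using compact_imp_bounded bounded_pos by (metis image_eqI real_norm_def)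
  show thesis
  proof (rule that[of B])
    fix u v assume "u \<in> {c..d}" "v \<in> {c..d}"
    then show "\<bar>\<psi> v - \<psi> u\<bar> \<le> B * \<bar>v - u\<bar>"
      using field_differentiable_bound[of "{c..d}" \<psi> \<psi>' B v u] B
        DERIV_subset[OF assms(1)] by auto
  qed (use B in auto)
qed

lemma abs_continuous_C1_compose_times_C1:
  assumes g: "abs_continuous_on_Icc a b g" "continuous_on {a..b} g"
    and \<psi>: "\<And>x. (\<psi> has_real_derivative \<psi>' x) (at x)" "continuous_on UNIV \<psi>'"
    and k: "\<And>x. (k has_real_derivative k' x) (at x)" "continuous_on UNIV k'"
  shows "abs_continuous_on_Icc a b (\<lambda>x. \<psi> (g x) * k x)"
proof -
  have "compact (g ` {a..b})" by (intro compact_continuous_image g) auto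
  then obtain M where M: "\<And>x. x \<in> {a..b} \<Longrightarrow> \<bar>g x\<bar> \<le> M"
    using compact_imp_bounded bounded_pos by (metis image_eqI real_norm_def)
  obtain L1 where L1: "0 \<le> L1" "\<And>u v. u \<in> {- M..M} \<Longrightarrow> v \<in> {- M..M} \<Longrightarrow> \<bar>\<psi> v - \<psi> u\<bar> \<le> L1 * \<bar>v - u\<bar>"
    using Lipschitz_on_Icc_if_C1[OF \<psi>] by metis
  obtain L2 where L2: "0 \<le> L2" "\<And>u v. u \<in> {a..b} \<Longrightarrow> v \<in> {a..b} \<Longrightarrow> \<bar>k v - k u\<bar> \<le> L2 * \<bar>v - u\<bar>"
    using Lipschitz_on_Icc_if_C1[OF k] by metis
  have "continuous_on {a..b} k" by (meson k(1) DERIV_continuous_on DERIV_subset subset_UNIV)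
  then have "compact (k ` {a..b})" by (intro compact_continuous_image) auto
  then obtain B2 where B2: "0 < B2" "\<And>x. x \<in> {a..b} \<Longrightarrow> \<bar>k x\<bar> \<le> B2"
    using compact_imp_bounded bounded_pos by (metis image_eqI real_norm_def)
  have "continuous_on {- M..M} \<psi>" by (meson \<psi>(1) DERIV_continuous_on DERIV_subset subset_UNIV)
  then have "compact (\<psi> ` {- M..M})" by (intro compact_continuous_image) auto
  then obtain B1 where B1: "0 < B1" "\<And>x. x \<in> {- M..M} \<Longrightarrow> \<bar>\<psi> x\<bar> \<le> B1"
    using compact_imp_bounded bounded_pos by (metis image_eqI real_norm_def)
  show ?thesis
  proof (rule abs_continuous_if_increments_bounded[OF g(1)])
    fix u v assume uv: "a \<le> u" "u \<le> v" "v \<le> b"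
    then have gM: "g u \<in> {- M..M}" "g v \<in> {- M..M}" using M[of u] M[of v] by auto
    have "\<psi> (g v) * k v - \<psi> (g u) * k u = (\<psi> (g v) - \<psi> (g u)) * k v + \<psi> (g u) * (k v - k u)"
      by (simp add: algebra_simps)
    then have "\<bar>\<psi> (g v) * k v - \<psi> (g u) * k u\<bar> \<le> \<bar>\<psi> (g v) - \<psi> (g u)\<bar> * \<bar>k v\<bar> + \<bar>\<psi> (g u)\<bar> * \<bar>k v - k u\<bar>"
      by (metis abs_triangle_ineq abs_mult)
    also have "\<dots> \<le> (L1 * \<bar>g v - g u\<bar>) * B2 + B1 * (L2 * \<bar>v - u\<bar>)"
      using uv gM L1(1) L2(1) B1(1) B2(1)
      by (intro add_mono mult_mono L1(2) L2(2) B1(2) B2(2)) auto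
    also have "\<dots> \<le> (L1 * B2 + B1 * L2) * (\<bar>g v - g u\<bar> + (v - u))"
    proof -
      have "0 \<le> L1 * B2 * (v - u)" "0 \<le> B1 * L2 * \<bar>g v - g u\<bar>" using L1 L2 B1 B2 uv by auto
      then show ?thesis using uv by (simp add: algebra_simps)
    qed
    finally show "\<bar>\<psi> (g v) * k v - \<psi> (g u) * k u\<bar> \<le> (L1 * B2 + B1 * L2) * (\<bar>g v - g u\<bar> + (v - u))" .
  qed
qed

section \<open>The integral inequality\<close>

text \<open>
  For \<open>p > 2\<close> this is Young's inequality for \<open>|u|\<^sup>p\<^sup>-\<^sup>2\<close> and \<open>(p - 1) |s|\<close> with the conjugate exponents
  \<open>p / (p - 2)\<close> and \<open>p / 2\<close>.  Unweighted, it gives the same constant as Hoelder's inequality for the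
  integrals would: once \<open>(1 - 2 / p) |u|\<^sup>p\<close> is absorbed into \<open>|u|\<^sup>p\<close>, the factor \<open>2 / p\<close> is left on
  both sides.
\<close>

lemma spow_deriv_Young:
  assumes p: "2 \<le> p"
  shows "spow_deriv (p - 1) u * \<bar>s\<bar> \<le>
    (1 - 2 / p) * \<bar>u\<bar> powr p + (2 / p) * (sqrt (p - 1) powr p * \<bar>s\<bar> powr (p / 2))"
proof (cases "p = 2")
  case True
  then show ?thesis by (simp add: spow_deriv_def)
next
  case False
  with p have p: "2 < p" by simp
  have "(\<bar>u\<bar> powr (p - 2)) * ((p - 1) * \<bar>s\<bar>) \<le>
      (\<bar>u\<bar> powr (p - 2)) powr (p / (p - 2)) / (p / (p - 2)) + ((p - 1) * \<bar>s\<bar>) powr (p / 2) / (p / 2)"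
    using p by (intro Youngs_inequality mult_nonneg_nonneg) (auto simp: field_simps)
  also have "(\<bar>u\<bar> powr (p - 2)) powr (p / (p - 2)) = \<bar>u\<bar> powr p"
    using p by (simp add: powr_powr)
  also have "((p - 1) * \<bar>s\<bar>) powr (p / 2) = sqrt (p - 1) powr p * \<bar>s\<bar> powr (p / 2)"
    using p by (simp add: powr_mult powr_half_sqrt[symmetric] powr_powr)
  finally show ?thesis
    using p by (simp add: spow_deriv_def field_simps)
qed

text \<open>
  If the right-hand integral is finite, all three functions are gauge integrable on \<open>[a, b]\<close> and the
  bound on the derivative of \<open>\<phi>\<close> can be integrated; no integrability of \<open>B\<close> is assumed.
\<close>

lemma nn_integral_le_if_derivative_bound:
  assumes \<phi>: "abs_continuous_on_Icc a b \<phi>" "a \<le> b"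
    and A: "continuous_on {a..b} A" "\<And>x. 0 \<le> A x"
    and B: "B \<in> borel_measurable lebesgue" "\<And>x. 0 \<le> B x"
    and ck: "0 < c" "0 < k"
    and deriv: "AE x in lebesgue. \<exists>D. (\<phi> has_real_derivative D) (at x) \<and> k * (A x - c * B x) \<le> D"
  shows "(\<integral>\<^sup>+x. ennreal (A x) * indicator {a..b} x \<partial>lebesgue) \<le>
    ennreal c * (\<integral>\<^sup>+x. ennreal (B x) \<partial>lebesgue) + ennreal ((\<phi> b - \<phi> a) / k)"
proof (cases "(\<integral>\<^sup>+x. ennreal (B x) \<partial>lebesgue) = \<infinity>")
  case True
  then show ?thesis using ck by (simp add: ennreal_mult_top)
next
  case False
  have Bi: "(\<lambda>x. indicator {a..b} x * B x) \<in> borel_measurable lebesgue"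
    using B(1) by (intro borel_measurable_times borel_measurable_indicator) auto
  have le: "(\<integral>\<^sup>+x. ennreal (indicator {a..b} x * B x) \<partial>lebesgue) \<le> (\<integral>\<^sup>+x. ennreal (B x) \<partial>lebesgue)"
    using B(2) by (intro nn_integral_mono) (auto simp: indicator_def)
  then obtain \<beta> where \<beta>: "(\<integral>\<^sup>+x. ennreal (indicator {a..b} x * B x) \<partial>lebesgue) = ennreal \<beta>" "0 \<le> \<beta>"
    using False by (cases "\<integral>\<^sup>+x. ennreal (indicator {a..b} x * B x) \<partial>lebesgue" rule: ennreal_cases)
      (auto simp: top_unique)
  have restrict: "((\<lambda>x. indicator {a..b} x * f x) has_integral i) UNIV \<longleftrightarrow> (f has_integral i) {a..b}"
    for f :: "real \<Rightarrow> real" and i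
  proof -
    have "(\<lambda>x. indicator {a..b} x * f x) = (\<lambda>x. if x \<in> {a..b} then f x else 0)"
      by (auto simp: indicator_def)
    then show ?thesis using has_integral_restrict_UNIV by metis
  qed
  have intB: "(B has_integral \<beta>) {a..b}"
    using Bi \<beta> B(2) by (subst restrict[symmetric], subst has_integral_iff_nn_integral_lebesgue) auto
  define \<alpha> where "\<alpha> = integral {a..b} A"
  have intA: "(A has_integral \<alpha>) {a..b}"
    unfolding \<alpha>_def by (intro integrable_integral integrable_continuous_interval A)
  have \<alpha>: "(\<integral>\<^sup>+x. ennreal (A x) * indicator {a..b} x \<partial>lebesgue) = ennreal \<alpha>"
  proof -
    have "((\<lambda>x. indicator {a..b} x * A x) has_integral \<alpha>) UNIV" using intA restrict by simp
    then have "(\<integral>\<^sup>+x. ennreal (indicator {a..b} x * A x) \<partial>lebesgue) = ennreal \<alpha>"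
      using A(2) by (subst (asm) has_integral_iff_nn_integral_lebesgue) auto
    also have "(\<lambda>x. ennreal (indicator {a..b} x * A x)) = (\<lambda>x. ennreal (A x) * indicator {a..b} x)"
      by (auto simp: indicator_def)
    finally show ?thesis .
  qed
  obtain N where N: "N \<in> null_sets lebesgue"
    "\<And>x. x \<notin> N \<Longrightarrow> \<exists>D. (\<phi> has_real_derivative D) (at x) \<and> k * (A x - c * B x) \<le> D"
    using deriv unfolding completion.AE_iff_null_sets by auto
  then obtain D where D: "\<And>x. x \<notin> N \<Longrightarrow> (\<phi> has_real_derivative D x) (at x) \<and> k * (A x - c * B x) \<le> D x"
    by metis
  \<comment> \<open>On the null set \<open>N\<close> the integrand may be chosen so that the bound holds everywhere.\<close>
  let ?D = "\<lambda>x. if x \<in> N then k * (A x - c * B x) else D x"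
  have upper: "(?D has_integral \<phi> b - \<phi> a) {a..b}"
    using N(1) D by (intro abs_continuous_has_integral[OF \<phi>, of N]) (auto simp: negligible_iff_null_sets)
  have lower: "((\<lambda>x. k * (A x - c * B x)) has_integral k * (\<alpha> - c * \<beta>)) {a..b}"
    by (intro has_integral_mult_right has_integral_diff intA intB)
  have "k * (\<alpha> - c * \<beta>) \<le> \<phi> b - \<phi> a"
    by (rule has_integral_le[OF lower upper]) (use D in auto)
  then have "\<alpha> \<le> c * \<beta> + (\<phi> b - \<phi> a) / k" using ck by (simp add: field_simps)
  then have "ennreal \<alpha> \<le> ennreal (c * \<beta> + (\<phi> b - \<phi> a) / k)" by (rule ennreal_leI)
  also have "\<dots> \<le> ennreal (c * \<beta>) + ennreal ((\<phi> b - \<phi> a) / k)"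
    using \<beta>(2) ck(1) by (cases "0 \<le> (\<phi> b - \<phi> a) / k")
      (auto simp: ennreal_plus ennreal_neg intro!: ennreal_leI)
  also have "ennreal (c * \<beta>) \<le> ennreal c * (\<integral>\<^sup>+x. ennreal (B x) \<partial>lebesgue)"
    using \<beta> ck le by (simp add: ennreal_mult mult_left_mono)
  finally show ?thesis unfolding \<alpha> by simp
qed

text \<open>
  A locally absolutely continuous almost everywhere primitive of a continuous function is a
  \<open>C\<^sup>1\<close> primitive.
\<close>

lemma primitive_has_derivative:
  assumes h: "continuous_on UNIV h" and H: "locally_abs_continuous H"
    and HD: "AE t in lebesgue. (H has_real_derivative h t) (at t)"
  shows "(H has_real_derivative h t) (at t)"
proof -
  obtain N where N: "N \<in> null_sets lebesgue" "\<And>x. x \<notin> N \<Longrightarrow> (H has_real_derivative h x) (at x)"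
    using HD unfolding completion.AE_iff_null_sets by auto
  have eq: "integral {t - 1..x} h + H (t - 1) = H x" if "t - 1 \<le> x" for x
    using abs_continuous_has_integral[OF locally_abs_continuous_Icc[OF H] that, of N h] N
    by (simp add: integral_unique negligible_iff_null_sets)
  have "((\<lambda>x. integral {t - 1..x} h) has_real_derivative h t) (at t within {t - 1..t + 1})"
    by (rule integral_has_real_derivative[OF continuous_on_subset[OF h]]) auto
  then have "((\<lambda>x. integral {t - 1..x} h + H (t - 1)) has_real_derivative h t) (at t)"
    by (auto intro!: derivative_eq_intros simp: at_within_Icc_at)
  then show ?thesis
    by (rule has_field_derivative_transform_within_open[of _ _ _ "{t - 1<..}"]) (auto intro: eq)
qed

lemma Young_derivative_bound:
  assumes "2 \<le> p" "0 \<le> w"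
  shows "(2 / p) * (\<bar>u\<bar> powr p * w - sqrt (p - 1) powr p * (\<bar>s * T\<bar> powr (p / 2) * w)) \<le>
    spow_deriv (p - 1) u * s * (T * w) + \<bar>u\<bar> powr p * w"
proof -
  have "0 \<le> spow_deriv (p - 1) u" using assms(1) by (auto simp: spow_deriv_def)
  then have "- (spow_deriv (p - 1) u * \<bar>s * T\<bar>) \<le> spow_deriv (p - 1) u * (s * T)"
    by (metis abs_ge_minus_self abs_mult abs_of_nonneg minus_le_iff)
  then have "(2 / p) * (\<bar>u\<bar> powr p - sqrt (p - 1) powr p * \<bar>s * T\<bar> powr (p / 2)) \<le>
      spow_deriv (p - 1) u * (s * T) + \<bar>u\<bar> powr p"
    using spow_deriv_Young[OF assms(1), of u "s * T"] by (simp add: algebra_simps)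
  from mult_right_mono[OF this assms(2)] show ?thesis by (simp add: algebra_simps)
qed

lemma Liminf_ereal_zero_imp_ex_less:
  fixes X :: "'a \<Rightarrow> real"
  assumes "Liminf F (\<lambda>r. ereal (X r)) = 0" "0 < \<epsilon>" "eventually P F"
  shows "\<exists>r. X r < \<epsilon> \<and> P r"
proof (rule ccontr)
  assume no: "\<not> ?thesis"
  have "eventually (\<lambda>r. ereal \<epsilon> \<le> ereal (X r)) F"
    using assms(3) by eventually_elim (use no in force)
  then have "ereal \<epsilon> \<le> Liminf F (\<lambda>r. ereal (X r))" by (rule Liminf_bounded)
  then show False using assms(1,2) by simp
qed

text \<open>
  Where \<open>g\<close> is not differentiable, \<open>deriv g\<close> is an unspecified value; completeness of the Lebesgue
  measure makes this irrelevant.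
\<close>

lemma borel_measurable_deriv_AE:
  fixes g :: "real \<Rightarrow> real"
  assumes g: "continuous_on UNIV g" and diff: "AE x in lebesgue. g differentiable (at x)"
  shows "deriv g \<in> borel_measurable lebesgue"
proof -
  define q where "q n x = (g (x + 1 / real (Suc n)) - g x) / (1 / real (Suc n))" for n x
  have "continuous_on UNIV (q n)" for n
    unfolding q_def[abs_def] by (intro continuous_intros continuous_on_compose2[OF g]) auto
  then have "(\<lambda>x. lim (\<lambda>n. q n x)) \<in> borel_measurable borel"
    by (intro borel_measurable_lim_metric borel_measurable_continuous_onI)
  then have "(\<lambda>x. lim (\<lambda>n. q n x)) \<in> borel_measurable lebesgue"
    by (simp add: measurable_completion)
  moreover have "AE x in lebesgue. lim (\<lambda>n. q n x) = deriv g x"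
    using diff
  proof eventually_elim
    case (elim x)
    then have "(g has_real_derivative deriv g x) (at x)"
      by (simp add: DERIV_deriv_iff_real_differentiable)
    then have "((\<lambda>d. (g (x + d) - g x) / d) \<longlongrightarrow> deriv g x) (at 0)"
      by (simp add: DERIV_def)
    moreover have "filterlim (\<lambda>n. 1 / real (Suc n)) (at 0) sequentially"
      unfolding filterlim_at
    proof
      show "(\<lambda>n. 1 / real (Suc n)) \<longlonglongrightarrow> 0" by (rule LIMSEQ_Suc[OF lim_1_over_n])
    qed auto
    ultimately have "(\<lambda>n. q n x) \<longlonglongrightarrow> deriv g x"
      unfolding q_def by (rule filterlim_compose)
    then show ?case by (rule limI)
  qed
  ultimately show ?thesis by (rule borel_measurable_AE)
qed

lemma nn_integral_le_if_Icc_le: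
  assumes A: "A \<in> borel_measurable lebesgue"
    and le: "\<And>n. (\<integral>\<^sup>+x. A x * indicator {- real n..real n} x \<partial>lebesgue) \<le> C"
  shows "(\<integral>\<^sup>+x. A x \<partial>lebesgue) \<le> C"
proof -
  have "(\<integral>\<^sup>+x. A x \<partial>lebesgue) = (\<integral>\<^sup>+x. (SUP n. A x * indicator {- real n..real n} x) \<partial>lebesgue)"
  proof (rule nn_integral_cong)
    fix x :: real
    show "A x = (SUP n. A x * indicator {- real n..real n} x)"
    proof (rule antisym)
      obtain n where "\<bar>x\<bar> \<le> real n" using real_arch_simple by blast
      then have "A x = A x * indicator {- real n..real n} x" by (auto simp: indicator_def)
      also have "\<dots> \<le> (SUP n. A x * indicator {- real n..real n} x)" by (rule SUP_upper) simp
      finally show "A x \<le> (SUP n. A x * indicator {- real n..real n} x)" .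
      show "(SUP n. A x * indicator {- real n..real n} x) \<le> A x"
        by (rule SUP_least) (auto simp: indicator_def)
    qed
  qed
  also have "\<dots> = (SUP n. \<integral>\<^sup>+x. A x * indicator {- real n..real n} x \<partial>lebesgue)"
  proof (rule nn_integral_monotone_convergence_SUP)
    show "incseq (\<lambda>n x. A x * indicator {- real n..real n} x)"
      by (auto simp: incseq_def le_fun_def indicator_def)
    show "(\<lambda>x. A x * indicator {- real n..real n} x) \<in> borel_measurable lebesgue" for n
      using A by (intro borel_measurable_times_ennreal borel_measurable_indicator) auto
  qed
  also have "\<dots> \<le> C" by (rule SUP_least) (rule le)
  finally show ?thesis .
qed


theorem proposition3p1:
  fixes p :: real and h H f :: "real \<Rightarrow> real"
  assumes "p \<ge> 2"
    and "continuous_on UNIV h"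
    and "\<And>t. h t \<ge> 0"
    and "\<And>t. t \<noteq> 0 \<Longrightarrow> h t > 0"
    and "locally_abs_continuous H"
    and "AE t in lebesgue. (H has_real_derivative h t) (at t)"
    and "f \<in> admissible p H"
  shows "(\<integral>\<^sup>+ x. ennreal (\<bar>deriv f x\<bar> powr p * h (f x)) \<partial>lebesgue)
    \<le> ennreal (sqrt (p - 1) powr p) *
      (\<integral>\<^sup>+ x. ennreal (\<bar>deriv (deriv f) x * transform H h (f x)\<bar> powr (p / 2) * h (f x)) \<partial>lebesgue)"
proof -
  define g where "g = deriv f"
  have fdiff: "f differentiable (at x)" for x
    using assms(7) by (simp add: admissible_def W21_loc_def)
  have f': "(f has_real_derivative g x) (at x)" for x
    using fdiff by (simp add: g_def DERIV_deriv_iff_real_differentiable)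
  have gAC: "locally_abs_continuous g"
    using assms(7) by (simp add: admissible_def W21_loc_def g_def)
  have liminf: "Liminf at_top (\<lambda>r. ereal (\<bar>g r\<bar> powr (p - 1) * \<bar>H (f r)\<bar>)) = 0"
    "Liminf at_bot (\<lambda>r. ereal (\<bar>g r\<bar> powr (p - 1) * \<bar>H (f r)\<bar>)) = 0"
    using assms(7) by (simp_all add: admissible_def g_def)
  have H': "(H has_real_derivative h t) (at t)" for t
    using primitive_has_derivative[OF assms(2,5,6)] .
  have cf: "continuous_on A f" for A
    by (meson f' DERIV_continuous_on DERIV_subset subset_UNIV)
  have cg: "continuous_on A g" for A
    using locally_abs_continuous_isCont[OF gAC] by (simp add: continuous_at_imp_continuous_on)
  have cH: "continuous_on A H" for A
    by (meson H' DERIV_continuous_on DERIV_subset subset_UNIV)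
  have chf: "continuous_on A (\<lambda>x. h (f x))" for A
    by (rule continuous_on_compose2[OF assms(2) cf]) simp
  have Hf': "((\<lambda>x. H (f x)) has_real_derivative h (f x) * g x) (at x)" for x
    by (rule DERIV_chain2[OF H' f'])
  have q1: "1 \<le> p - 1" using assms(1) by simp
  have gdiff: "AE x in lebesgue. g differentiable (at x)"
    by (rule locally_abs_continuous_differentiable_AE[OF gAC])
  \<comment> \<open>This is \<open>|f'|\<^sup>p\<^sup>-\<^sup>2 f' H(f)\<close>, whose absolute value appears in the boundary conditions.\<close>
  define \<phi> where "\<phi> x = spow (p - 1) (g x) * H (f x)" for x
  have \<phi>AC: "abs_continuous_on_Icc a b \<phi>" for a b
    unfolding \<phi>_def[abs_def]
    by (rule abs_continuous_C1_compose_times_C1[OF locally_abs_continuous_Icc[OF gAC] cg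
          spow_has_derivative[OF q1] continuous_spow_deriv[OF q1] Hf'])
      (intro continuous_intros chf cg)
  define A where "A x = \<bar>g x\<bar> powr p * h (f x)" for x
  define B where "B x = \<bar>deriv g x * transform H h (f x)\<bar> powr (p / 2) * h (f x)" for x
  have cA: "continuous_on S A" for S
    unfolding A_def[abs_def] using assms(1) by (intro continuous_intros continuous_on_powr' chf cg) auto
  have A0: "0 \<le> A x" and B0: "0 \<le> B x" for x using assms(3) by (auto simp: A_def B_def)
  have Bm: "B \<in> borel_measurable lebesgue"
  proof -
    have [measurable]: "h \<in> borel_measurable borel" "H \<in> borel_measurable borel" "f \<in> borel_measurable borel"
      using assms(2) cH cf by (auto intro: borel_measurable_continuous_onI)
    have "(\<lambda>x. transform H h (f x)) \<in> borel_measurable borel"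
      unfolding transform_def by measurable
    then have [measurable]: "(\<lambda>x. transform H h (f x)) \<in> borel_measurable lebesgue"
      by (simp add: measurable_completion)
    have [measurable]: "(\<lambda>x. h (f x)) \<in> borel_measurable lebesgue"
      by (rule measurable_completion) measurable
    have [measurable]: "deriv g \<in> borel_measurable lebesgue"
      by (rule borel_measurable_deriv_AE[OF cg gdiff])
    show ?thesis unfolding B_def[abs_def] by measurable
  qed
  have ae: "AE x in lebesgue. \<exists>D. (\<phi> has_real_derivative D) (at x) \<and>
      2 / p * (A x - sqrt (p - 1) powr p * B x) \<le> D"
  proof -
    let ?Z = "\<lambda>F. {x :: real. F x = (0 :: real) \<and> (\<exists>D. D \<noteq> 0 \<and> (F has_real_derivative D) (at x))}"
    have Z: "AE x in lebesgue. x \<notin> ?Z F" for F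
      using negligible_zeros_with_nonzero_derivative[of F]
      by (intro AE_not_in) (simp add: negligible_iff_null_sets)
    show ?thesis using gdiff Z[of f] Z[of g]
    proof eventually_elim
      case (elim x)
      then have g': "(g has_real_derivative deriv g x) (at x)"
        by (simp add: DERIV_deriv_iff_real_differentiable)
      let ?D = "spow_deriv (p - 1) (g x) * deriv g x * H (f x) + h (f x) * g x * spow (p - 1) (g x)"
      have "(\<phi> has_real_derivative ?D) (at x)"
        unfolding \<phi>_def[abs_def]
        by (rule DERIV_mult[OF DERIV_chain2[OF spow_has_derivative[OF q1] g'] Hf'])
      also have "h (f x) * g x * spow (p - 1) (g x) = A x"
        using spow_mult[of p "g x"] by (simp add: A_def algebra_simps)
      finally have D: "(\<phi> has_real_derivative spow_deriv (p - 1) (g x) * deriv g x * H (f x) + A x) (at x)" .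
      have "2 / p * (A x - sqrt (p - 1) powr p * B x) \<le> spow_deriv (p - 1) (g x) * deriv g x * H (f x) + A x"
      proof (cases "h (f x) = 0")
        case False
        then have "H (f x) = transform H h (f x) * h (f x)" by (simp add: transform_def)
        then show ?thesis
          using Young_derivative_bound[OF assms(1) assms(3)[of "f x"], of "g x" "deriv g x" "transform H h (f x)"]
          by (simp add: A_def B_def)
      next
        case True
        \<comment> \<open>The transform is \<open>0\<close> here although \<open>H 0\<close> need not be; but \<open>f\<close>, \<open>f'\<close> and \<open>f''\<close> all vanish.\<close>
        then have "f x = 0" using assms(4)[of "f x"] by (cases "f x = 0") auto
        then have "g x = 0" using elim(2) f'[of x] by blast
        then have "deriv g x = 0" using elim(3) g' by blast
        then show ?thesis using True by (simp add: A_def B_def)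
      qed
      then show ?case using D by blast
    qed
  qed
  let ?C = "sqrt (p - 1) powr p"
  have C: "0 < ?C" using assms(1) by simp
  have k: "0 < 2 / p" using assms(1) by simp
  have \<phi>abs: "\<bar>\<phi> x\<bar> = \<bar>g x\<bar> powr (p - 1) * \<bar>H (f x)\<bar>" for x
    by (simp add: \<phi>_def abs_mult abs_spow)
  have "(\<integral>\<^sup>+x. ennreal (A x) \<partial>lebesgue) \<le> ennreal ?C * (\<integral>\<^sup>+x. ennreal (B x) \<partial>lebesgue)"
  proof (rule nn_integral_le_if_Icc_le)
    have "A \<in> borel_measurable borel" by (rule borel_measurable_continuous_onI[OF cA])
    then show "(\<lambda>x. ennreal (A x)) \<in> borel_measurable lebesgue"
      by (intro measurable_compose[OF _ measurable_ennreal] measurable_completion) simp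
    fix n
    show "(\<integral>\<^sup>+x. ennreal (A x) * indicator {- real n..real n} x \<partial>lebesgue) \<le>
        ennreal ?C * (\<integral>\<^sup>+x. ennreal (B x) \<partial>lebesgue)"
    proof (rule ennreal_le_epsilon)
      fix e :: real assume e: "0 < e"
      then have e': "0 < e / p" using assms(1) by simp
      \<comment> \<open>The endpoints can be taken independently of each other, so lower limits suffice.\<close>
      obtain b where b: "\<bar>\<phi> b\<bar> < e / p" "real n \<le> b"
        using Liminf_ereal_zero_imp_ex_less[OF liminf(1) e' eventually_ge_at_top[of "real n"]] \<phi>abs by metis
      obtain a where a: "\<bar>\<phi> a\<bar> < e / p" "a \<le> - real n"
        using Liminf_ereal_zero_imp_ex_less[OF liminf(2) e' eventually_le_at_bot[of "- real n"]] \<phi>abs by metis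
      have "(\<integral>\<^sup>+x. ennreal (A x) * indicator {- real n..real n} x \<partial>lebesgue) \<le>
          (\<integral>\<^sup>+x. ennreal (A x) * indicator {a..b} x \<partial>lebesgue)"
        using a b by (intro nn_integral_mono) (auto simp: indicator_def)
      also have "\<dots> \<le> ennreal ?C * (\<integral>\<^sup>+x. ennreal (B x) \<partial>lebesgue) + ennreal ((\<phi> b - \<phi> a) / (2 / p))"
        using a b by (intro nn_integral_le_if_derivative_bound[OF \<phi>AC _ cA A0 Bm B0 C k ae]) auto
      also have "(\<phi> b - \<phi> a) / (2 / p) \<le> e"
      proof -
        have "\<phi> b - \<phi> a \<le> 2 * (e / p)" using a(1) b(1) by linarith
        then have "\<phi> b - \<phi> a \<le> e * (2 / p)" by (simp add: mult.commute)
        then show ?thesis using k by (simp only: pos_divide_le_eq)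
      qed
      finally show "(\<integral>\<^sup>+x. ennreal (A x) * indicator {- real n..real n} x \<partial>lebesgue) \<le>
        ennreal ?C * (\<integral>\<^sup>+x. ennreal (B x) \<partial>lebesgue) + ennreal e"
        by (simp add: ennreal_leI)
    qed
  qed
  then show ?thesis by (simp add: A_def B_def g_def)
qed

end
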